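(* Consider the single-cell uplink with predicted CSI (predictor order $p$) and ZF receivers described in the context, with $K$, $\tau$, $\alpha$, $p$ and $\beta_1,\dots,\beta_K$ fixed, and fix $E_u>0$. Each user can scale down its transmit power at most by $p_u=E_u/\sqrt M$, in the following sense: for every $k\in\{1,\dots,K\}$, if $p_u=E_u/\sqrt M$ then $$R_k^{\mathrm{p,zf}}\longrightarrow\log_2\left(1+\alpha^2\sum_{j=0}^p\alpha^{2j}\,\tau E_u^2\beta_k^2\right)\qquad(M\to\infty),$$ whereas if $p_u=E_u/M^\gamma$ with $\gamma>\frac12$ then $R_k^{\mathrm{p,zf}}\to0$ as $M\to\infty$.
   Context: System: a base station (BS) with $M$ antennas and $K\le M$ single-antenna users; $p_u>0$ is the transmit power per user, $\tau\ge K$ the (integer) training length, $p_p:=\tau p_u$, and $\beta_1,\dots,\beta_K>0$ are constants. The channel of user $k$ is a stationary process $\mathbf g_k[n]\in\mathbb C^M$ with i.i.d. $\mathcal{CN}(0,\beta_k)$ entries, independent across users, satisfying $\mathbf g_k[n+1]=\alpha\mathbf g_k[n]+\mathbf e_k[n+1]$, with $\alpha$ real, $0<|\alpha|\le1$, and $\mathbf e_k[n+1]$ having i.i.d. $\mathcal{CN}(0,(1-\alpha^2)\beta_k)$ entries, independent over time and of the past. The BS observes $\tilde{\mathbf y}_k[n]=\mathbf g_k[n]+\frac1{\sqrt{p_p}}\mathbf b_k[n]$, with $\mathbf b_k[n]$ having i.i.d. $\mathcal{CN}(0,1)$ entries, independent over $k$ and $n$ and of the channels. Prediction: let $p\ge0$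 be an integer (predictor order), $\bar{\mathbf y}_k[n]=[\tilde{\mathbf y}_k^T[n],\tilde{\mathbf y}_k^T[n-1],\dots,\tilde{\mathbf y}_k^T[n-p]]^T$, $\delta(p,\alpha)=[1\ \alpha\ \cdots\ \alpha^p]$, $\Delta(p,\alpha)$ the $(p+1)\times(p+1)$ matrix with $(i,j)$ entry $\alpha^{|i-j|}$, and $$\mathbf T_k(p,\alpha)=\beta_k[\Delta(p,\alpha)\otimes\mathbf I_M]+\tfrac1{p_p}\mathbf I_{M(p+1)}.$$ The predicted channel is $\breve{\mathbf g}_k[n+1]=\mathbf q_k\bar{\mathbf y}_k[n]$ with $\mathbf q_k=\alpha\beta_k[\delta(p,\alpha)\otimes\mathbf I_M]\mathbf T_k^{-1}(p,\alpha)$. Its covariance matrix is $\alpha^2\boldsymbol\Theta_k(p,\alpha)$, where $$\boldsymbol\Theta_k(p,\alpha)=\beta_k^2[\delta(p,\alpha)\otimes\mathbf I_M]\mathbf T_k^{-1}(p,\alpha)[\delta(p,\alpha)\otimes\mathbf I_M]^\dagger .$$ Write $\breve{\mathbf G}=[\breve{\mathbf g}_1[n+1],\dots,\breve{\mathbf g}_K[n+1]]\in\mathbb C^{M\times K}$. Rate: with linear detector vector $\hat{\mathbf a}_k$ and $\breve{\mathbf g}_i=\breve{\mathbf g}_i[n+1]$, the achievable rate of user $k$ is defined as $R_k^{\mathrm p}=\mathrm E\{\log_2(1+\mathrm{SINR}_k^{\mathrm p})\}$ with $$\mathrm{SINR}_k^{\mathrm p}=\frac{p_u|\hat{\mathbf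 a}_k^\dagger\breve{\mathbf g}_k|^2}{p_u\sum_{i\ne k}|\hat{\mathbf a}_k^\dagger\breve{\mathbf g}_i|^2+\|\hat{\mathbf a}_k\|^2\left(p_u\sum_{i=1}^K\frac1M\mathrm{tr}(\beta_i\mathbf I_M-\alpha^2\boldsymbol\Theta_i(p,\alpha))+1\right)}.$$ The ZF receiver takes $\hat{\mathbf a}_k$ to be the $k$-th column of $\breve{\mathbf G}(\breve{\mathbf G}^\dagger\breve{\mathbf G})^{-1}$ (the inverse exists almost surely), and the resulting rate is denoted $R_k^{\mathrm{p,zf}}$. *)

theory Defs
  imports
    "HOL-Probability.Probability"
    "Jordan_Normal_Form.Gauss_Jordan_Elimination"
    "Jordan_Normal_Form.Schur_Decomposition"
begin

section \<open>Random processes\<close>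

text \<open>
  The circularly symmetric complex normal law with total variance \<open>v\<close>, so that the real and the
  imaginary part have variance \<open>v / 2\<close> each. For \<open>v = 0\<close> it is the point mass at \<open>0\<close>; this is
  needed for the innovations when the temporal correlation has modulus \<open>1\<close>.
\<close>

definition cnormal :: "real \<Rightarrow> complex measure" where
  "cnormal v =
     distr (density lborel std_normal_density \<Otimes>\<^sub>M density lborel std_normal_density) borel
       (\<lambda>(x, y). Complex (sqrt (v / 2) * x) (sqrt (v / 2) * y))"

definition iid_cnormal :: "'w measure \<Rightarrow> real \<Rightarrow> ('i \<Rightarrow> 'w \<Rightarrow> complex) \<Rightarrow> 'i set \<Rightarrow> bool" where
  "iid_cnormal P v X I \<longleftrightarrow>
     prob_space.indep_vars P (\<lambda>_. borel) X I \<and> (\<forall>i\<in>I. distr P borel (X i) = cnormal v)"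

text \<open>A family of scalar random variables, regarded as one random element of a product space.\<close>

definition joint :: "('i \<Rightarrow> 'w \<Rightarrow> complex) \<Rightarrow> 'i set \<Rightarrow> 'w \<Rightarrow> 'i \<Rightarrow> complex" where
  "joint X I = (\<lambda>\<omega>. \<lambda>i\<in>I. X i \<omega>)"

abbreviation borel_prod :: "'i set \<Rightarrow> ('i \<Rightarrow> complex) measure" where
  "borel_prod I \<equiv> Pi\<^sub>M I (\<lambda>_. borel)"

text \<open>
  Users are \<open>k < K\<close>, antennas are \<open>m < M\<close>, and time runs over the integers. The random variable
  \<open>g k n m\<close> is entry \<open>m\<close> of the channel of user \<open>k\<close> at time \<open>n\<close>; \<open>e\<close> is the innovation and \<open>b\<close>
  the unit-variance observation noise. The transmit power enters none of these.
\<close>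

locale uplink = prob_space P
  for P :: "'w measure" +
  fixes M K :: nat
    and \<alpha> :: real
    and \<beta> :: "nat \<Rightarrow> real"
    and g e b :: "nat \<Rightarrow> int \<Rightarrow> nat \<Rightarrow> 'w \<Rightarrow> complex"
  assumes channel_entries: "k < K \<Longrightarrow> iid_cnormal P (\<beta> k) (g k n) {..<M}"
    and channel_stationary: "k < K \<Longrightarrow>
      distr P (borel_prod (UNIV \<times> {..<M})) (joint (\<lambda>(n, m). g k (n + h) m) (UNIV \<times> {..<M})) =
      distr P (borel_prod (UNIV \<times> {..<M})) (joint (\<lambda>(n, m). g k n m) (UNIV \<times> {..<M}))"
    and channels_indep: "indep_vars (\<lambda>_. borel_prod (UNIV \<times> {..<M}))
      (\<lambda>k. joint (\<lambda>(n, m). g k n m) (UNIV \<times> {..<M})) {..<K}"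
    and channel_step: "k < K \<Longrightarrow> m < M \<Longrightarrow>
      AE \<omega> in P. g k (n + 1) m \<omega> = of_real \<alpha> * g k n m \<omega> + e k (n + 1) m \<omega>"
    and innovation_entries: "k < K \<Longrightarrow> iid_cnormal P ((1 - \<alpha>\<^sup>2) * \<beta> k) (e k n) {..<M}"
    and innovations_indep: "k < K \<Longrightarrow>
      indep_vars (\<lambda>_. borel_prod {..<M}) (\<lambda>n. joint (e k n) {..<M}) UNIV"
    and innovation_indep_past: "k < K \<Longrightarrow>
      indep_var
        (borel_prod ({n + 1} \<times> {..<M})) (joint (\<lambda>(l, m). e k l m) ({n + 1} \<times> {..<M}))
        (borel_prod ({..n} \<times> {..<M})) (joint (\<lambda>(l, m). g k l m) ({..n} \<times> {..<M}))"
    and noise_entries: "iid_cnormal P 1 (\<lambda>(k, n, m). b k n m) ({..<K} \<times> UNIV \<times> {..<M})"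
    and noise_indep_channels:
      "indep_var
        (borel_prod ({..<K} \<times> UNIV \<times> {..<M}))
        (joint (\<lambda>(k, n, m). b k n m) ({..<K} \<times> UNIV \<times> {..<M}))
        (borel_prod ({..<K} \<times> UNIV \<times> {..<M}))
        (joint (\<lambda>(k, n, m). g k n m) ({..<K} \<times> UNIV \<times> {..<M}))"


section \<open>Matrices\<close>

definition kron :: "'a::times mat \<Rightarrow> 'a mat \<Rightarrow> 'a mat" (infixl \<open>\<otimes>\<^sub>K\<close> 72) where
  "A \<otimes>\<^sub>K B = mat (dim_row A * dim_row B) (dim_col A * dim_col B)
     (\<lambda>(i, j). A $$ (i div dim_row B, j div dim_col B) * B $$ (i mod dim_row B, j mod dim_col B))"

text \<open>The zero matrix stands for the inverse of a singular matrix.\<close>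

definition minv :: "'a::field mat \<Rightarrow> 'a mat" where
  "minv A = (case mat_inverse A of Some B \<Rightarrow> B | None \<Rightarrow> 0\<^sub>m (dim_row A) (dim_col A))"

definition mat_trace :: "'a::comm_monoid_add mat \<Rightarrow> 'a" where
  "mat_trace A = (\<Sum>i<dim_row A. A $$ (i, i))"

definition sq_vnorm :: "complex vec \<Rightarrow> real" where
  "sq_vnorm v = (\<Sum>i<dim_vec v. (cmod (v $ i))\<^sup>2)"


section \<open>Channel prediction\<close>

text \<open>
  In this section \<open>\<beta>\<close> is the large-scale coefficient of a single user, \<open>pp\<close> is the pilot power and
  \<open>p\<close> is the predictor order.
\<close>

definition delta_row :: "nat \<Rightarrow> real \<Rightarrow> complex mat" where
  "delta_row p \<alpha> = mat 1 (p + 1) (\<lambda>(i, j). of_real (\<alpha> ^ j))"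

definition Delta_mat :: "nat \<Rightarrow> real \<Rightarrow> complex mat" where
  "Delta_mat p \<alpha> = mat (p + 1) (p + 1) (\<lambda>(i, j). of_real (\<alpha> ^ nat \<bar>int i - int j\<bar>))"

definition T_mat :: "nat \<Rightarrow> real \<Rightarrow> real \<Rightarrow> nat \<Rightarrow> real \<Rightarrow> complex mat" where
  "T_mat M pp \<beta> p \<alpha> =
     of_real \<beta> \<cdot>\<^sub>m (Delta_mat p \<alpha> \<otimes>\<^sub>K 1\<^sub>m M) + of_real (1 / pp) \<cdot>\<^sub>m 1\<^sub>m (M * (p + 1))"

definition q_mat :: "nat \<Rightarrow> real \<Rightarrow> real \<Rightarrow> nat \<Rightarrow> real \<Rightarrow> complex mat" where
  "q_mat M pp \<beta> p \<alpha> =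
     of_real (\<alpha> * \<beta>) \<cdot>\<^sub>m ((delta_row p \<alpha> \<otimes>\<^sub>K 1\<^sub>m M) * minv (T_mat M pp \<beta> p \<alpha>))"

definition Theta_mat :: "nat \<Rightarrow> real \<Rightarrow> real \<Rightarrow> nat \<Rightarrow> real \<Rightarrow> complex mat" where
  "Theta_mat M pp \<beta> p \<alpha> =
     of_real (\<beta>\<^sup>2) \<cdot>\<^sub>m
       ((delta_row p \<alpha> \<otimes>\<^sub>K 1\<^sub>m M) * minv (T_mat M pp \<beta> p \<alpha>)
          * mat_adjoint (delta_row p \<alpha> \<otimes>\<^sub>K 1\<^sub>m M))"

text \<open>The arguments \<open>g\<close> and \<open>b\<close> below are the entry processes of a single user, indexed by time and
  antenna.\<close>

definition observation ::
  "real \<Rightarrow> (int \<Rightarrow> nat \<Rightarrow> 'w \<Rightarrow> complex) \<Rightarrow> (int \<Rightarrow> nat \<Rightarrow> 'w \<Rightarrow> complex)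
    \<Rightarrow> int \<Rightarrow> nat \<Rightarrow> 'w \<Rightarrow> complex" where
  "observation pp g b n m \<omega> = g n m \<omega> + of_real (1 / sqrt pp) * b n m \<omega>"

text \<open>Block \<open>j\<close> of the stacked vector, for \<open>j \<le> p\<close>, is the observation at time \<open>n - j\<close>.\<close>

definition stacked_observation ::
  "nat \<Rightarrow> real \<Rightarrow> nat \<Rightarrow> (int \<Rightarrow> nat \<Rightarrow> 'w \<Rightarrow> complex) \<Rightarrow> (int \<Rightarrow> nat \<Rightarrow> 'w \<Rightarrow> complex)
    \<Rightarrow> int \<Rightarrow> 'w \<Rightarrow> complex vec" where
  "stacked_observation M pp p g b n \<omega> =
     vec (M * (p + 1)) (\<lambda>i. observation pp g b (n - int (i div M)) (i mod M) \<omega>)"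

text \<open>The prediction, made at time \<open>n\<close>, of the channel at time \<open>n + 1\<close>.\<close>

definition predicted_channel ::
  "nat \<Rightarrow> real \<Rightarrow> real \<Rightarrow> nat \<Rightarrow> real \<Rightarrow> (int \<Rightarrow> nat \<Rightarrow> 'w \<Rightarrow> complex)
    \<Rightarrow> (int \<Rightarrow> nat \<Rightarrow> 'w \<Rightarrow> complex) \<Rightarrow> int \<Rightarrow> 'w \<Rightarrow> complex vec" where
  "predicted_channel M pp \<beta> p \<alpha> g b n \<omega> =
     q_mat M pp \<beta> p \<alpha> *\<^sub>v stacked_observation M pp p g b n \<omega>"


section \<open>Achievable rate\<close>

text \<open>
  The SINR of user \<open>k\<close> for detector vector \<open>a\<close> and predicted channel vectors \<open>h\<close>. The product
  \<open>h i \<bullet>c a\<close> is linear in \<open>h i\<close> and conjugate-linear in \<open>a\<close>. The trace is real because its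
  argument is Hermitian.
\<close>

definition sinr ::
  "nat \<Rightarrow> nat \<Rightarrow> real \<Rightarrow> real \<Rightarrow> (nat \<Rightarrow> real) \<Rightarrow> nat \<Rightarrow> real
    \<Rightarrow> complex vec \<Rightarrow> (nat \<Rightarrow> complex vec) \<Rightarrow> nat \<Rightarrow> real" where
  "sinr M K pu pp \<beta> p \<alpha> a h k =
     pu * (cmod (h k \<bullet>c a))\<^sup>2 /
     (pu * (\<Sum>i\<in>{..<K} - {k}. (cmod (h i \<bullet>c a))\<^sup>2)
      + sq_vnorm a *
        (pu * (\<Sum>i<K. 1 / real M *
           Re (mat_trace (of_real (\<beta> i) \<cdot>\<^sub>m 1\<^sub>m M - of_real (\<alpha>\<^sup>2) \<cdot>\<^sub>m Theta_mat M pp (\<beta> i) p \<alpha>)))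
         + 1))"

definition zf_detector :: "nat \<Rightarrow> nat \<Rightarrow> (nat \<Rightarrow> complex vec) \<Rightarrow> nat \<Rightarrow> complex vec" where
  "zf_detector M K h k =
     (let G = mat_of_cols M (map h [0..<K]) in col (G * minv (mat_adjoint G * G)) k)"

text \<open>
  The rate of user \<open>k\<close> with training length \<open>\<tau>\<close> and transmit power \<open>pu\<close>, for the channel
  predicted at time \<open>n\<close>.
\<close>

definition zf_rate ::
  "'w measure \<Rightarrow> nat \<Rightarrow> nat \<Rightarrow> nat \<Rightarrow> real \<Rightarrow> nat \<Rightarrow> real \<Rightarrow> (nat \<Rightarrow> real)
    \<Rightarrow> (nat \<Rightarrow> int \<Rightarrow> nat \<Rightarrow> 'w \<Rightarrow> complex) \<Rightarrow> (nat \<Rightarrow> int \<Rightarrow> nat \<Rightarrow> 'w \<Rightarrow> complex)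
    \<Rightarrow> int \<Rightarrow> nat \<Rightarrow> real" where
  "zf_rate P M K \<tau> pu p \<alpha> \<beta> g b n k =
     (let pp = real \<tau> * pu;
          h = (\<lambda>\<omega> i. predicted_channel M pp (\<beta> i) p \<alpha> (g i) (b i) n \<omega>)
      in prob_space.expectation P (\<lambda>\<omega>.
           log 2 (1 + sinr M K pu pp \<beta> p \<alpha> (zf_detector M K (h \<omega>) k) (h \<omega>) k)))"

end

theory Submission
  imports Defs "HOL-Real_Asymp.Real_Asymp"
begin

text \<open>
  Zero forcing makes every interference term vanish and gives \<open>\<parallel>a\<^sub>k\<parallel>\<^sup>2 = ((G\<^sup>* G)\<^sup>-\<^sup>1)\<^sub>k\<^sub>k\<close>, so the SINR is
  a deterministic multiple of \<open>1 / ((G\<^sup>* G)\<^sup>-\<^sup>1)\<^sub>k\<^sub>k\<close>. As the pilot power tends to \<open>0\<close>, the matrix \<open>T\<close>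
  becomes a multiple of the identity and the observations are dominated by the noise, so the law of
  large numbers for products of independent noise entries makes the normalised Gram matrix converge in
  \<open>L\<^sup>1\<close> to a diagonal matrix; the correlation structure of the channels plays no role.
  The quantity \<open>1 / ((G\<^sup>* G)\<^sup>-\<^sup>1)\<^sub>k\<^sub>k\<close> lies between \<open>0\<close> and \<open>(G\<^sup>* G)\<^sub>k\<^sub>k\<close>, and for nearly diagonal Gram
  matrices it is close to the diagonal entry; hence its distance to the limit is bounded everywhere,
  even where the Gram matrix is singular, by a constant times the entrywise error, and its \<open>L\<^sup>1\<close>
  convergence needs no uniform integrability argument. The logarithm is Lipschitz on \<open>[1, \<infinity>)\<close>,
  which carries the convergence over to the rate.
\<close>

section \<open>Matrix inverses near diagonal matrices\<close>

text \<open>The critical exponent comes from the power entering twice. The noise in an observation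
  has variance \<open>1 / pp\<close>; multiplied by \<open>sqrt pp\<close>, the observation is unit
  noise plus \<open>sqrt pp\<close> times the channel. The predictor carries a factor
  \<open>pp\<close>, so a predicted entry is of order \<open>sqrt pp\<close> and the Gram matrix of
  order \<open>M * pp\<close>. The SINR multiplies this by \<open>pu\<close> while its denominator
  tends to \<open>1\<close>, and \<open>pp\<close> is \<open>\<tau> * pu\<close>; hence only the
  limit \<open>L\<close> of \<open>pu^2 * M\<close> matters. It is the square of the energy constant
  for the square root scaling and \<open>0\<close> for every larger exponent, so a single limit
  theorem with parameter \<open>L\<close> serves both claims. The probability space itself changes
  with \<open>M\<close>, so almost sure convergence has no meaning here. Everything is expressed
  through expectations, and the law of large numbers is a quantitative second moment bound valid in
  each space. A further reduction is algebraic: the matrices grow with \<open>M\<close>, but each is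
  a Kronecker product of a matrix of fixed size \<open>p + 1\<close> with an identity, so every
  inverse whose limit is needed has a fixed size.\<close>

lemma mat_adjoint_dim [simp]:
  "dim_row (mat_adjoint A) = dim_col A" "dim_col (mat_adjoint A) = dim_row A"
  by (simp_all add: mat_adjoint_def)

lemma mat_adjoint_index:
  assumes "i < dim_col A" "j < dim_row A"
  shows "mat_adjoint A $$ (i, j) = conjugate (A $$ (j, i))"
  using assms by (simp add: mat_adjoint_def mat_of_rows_index)

lemma mult_mat_index:
  assumes "i < dim_row A" "j < dim_col B" "dim_col A = dim_row B"
  shows "(A * B) $$ (i, j) = (\<Sum>l<dim_row B. A $$ (i, l) * B $$ (l, j))"
  using assms by (auto simp: scalar_prod_def atLeast0LessThan intro!: sum.cong)

lemma mult_mat_vec_index: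
  assumes "i < dim_row A" "dim_col A = dim_vec v"
  shows "(A *\<^sub>v v) $ i = (\<Sum>j<dim_vec v. A $$ (i, j) * v $ j)"
  using assms by (auto simp: scalar_prod_def atLeast0LessThan intro!: sum.cong)

lemma minv_singular:
  assumes "A \<in> carrier_mat n n" "det A = 0"
  shows "minv A = 0\<^sub>m n n"
proof (cases "mat_inverse A")
  case None
  then show ?thesis using assms by (auto simp: minv_def)
next
  case (Some B)
  then have "A * B = 1\<^sub>m n" "B \<in> carrier_mat n n"
    using mat_inverse(2)[OF assms(1) Some] by auto
  then have "det A * det B = 1"
    by (metis det_mult[OF assms(1)] det_one)
  then show ?thesis using assms by simp
qed

text \<open>A one-sided inverse of a square matrix over a field is two-sided, which makes the matrix
  a unit, so \<open>mat_inverse\<close> succeeds; uniqueness of inverses does the rest.\<close>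

lemma minv_eqI:
  fixes A B :: "'a::field mat"
  assumes A: "A \<in> carrier_mat n n" and B: "B \<in> carrier_mat n n" and AB: "A * B = 1\<^sub>m n"
  shows "minv A = B"
proof -
  have BA: "B * A = 1\<^sub>m n" by (rule mat_mult_left_right_inverse[OF A B AB])
  have "det A * det B = 1"
    using AB by (metis det_mult[OF A B] det_one)
  then have "det A \<noteq> 0" by auto
  then have "A \<in> Units (ring_mat TYPE('a) n ())" by (rule det_non_zero_imp_unit[OF A])
  then obtain C where C: "mat_inverse A = Some C"
    using mat_inverse(1)[OF A, of "()"] by fastforce
  then have C': "A * C = 1\<^sub>m n" "C * A = 1\<^sub>m n" "C \<in> carrier_mat n n"
    using mat_inverse(2)[OF A C] by auto
  have "C = C * (A * B)" using AB C' by simp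
  also have "\<dots> = (C * A) * B" by (rule assoc_mult_mat[OF C'(3) A B, symmetric])
  also have "\<dots> = B" using C' B by simp
  finally show ?thesis using C by (simp add: minv_def)
qed

text \<open>The adjugate formula survives for singular \<open>A\<close> because
  \<open>inverse 0 = 0\<close> agrees with the default value of \<open>minv\<close>. It writes the
  inverse through determinants, which later gives measurability without a case split.\<close>

lemma minv_eq_adj_mat:
  fixes A :: "'a::field mat"
  assumes A: "A \<in> carrier_mat n n"
  shows "minv A = inverse (det A) \<cdot>\<^sub>m adj_mat A"
proof (cases "det A = 0")
  case True
  then show ?thesis using minv_singular[OF A] adj_mat(1)[OF A] by (auto intro!: eq_matI)
next
  case False
  have "A * (inverse (det A) \<cdot>\<^sub>m adj_mat A) = inverse (det A) \<cdot>\<^sub>m (det A \<cdot>\<^sub>m 1\<^sub>m n)"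
    using mult_smult_distrib[OF A adj_mat(1)[OF A]] adj_mat(2)[OF A] by simp
  also have "\<dots> = 1\<^sub>m n" using False by (auto intro!: eq_matI)
  finally show ?thesis
    using adj_mat(1)[OF A] by (intro minv_eqI[OF A]) auto
qed

lemma mult_minv:
  fixes A :: "'a::field mat"
  assumes A: "A \<in> carrier_mat n n" and "det A \<noteq> 0"
  shows "A * minv A = 1\<^sub>m n"
  using mult_smult_distrib[OF A adj_mat(1)[OF A]] adj_mat(2)[OF A] assms
  by (auto simp: minv_eq_adj_mat[OF A] intro!: eq_matI)

lemma minv_carrier:
  fixes A :: "'a::field mat"
  assumes A: "A \<in> carrier_mat n n"
  shows "minv A \<in> carrier_mat n n"
  using adj_mat(1)[OF A] by (simp add: minv_eq_adj_mat[OF A])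

text \<open>A perturbation bound for an arbitrary solution \<open>x\<close> of a linear system, with
  no inverse presupposed. With \<open>y = 0\<close> it shows that the kernel is trivial, and with
  \<open>y\<close> a unit vector it locates a column of the inverse.\<close>

lemma near_diagonal_solution:
  fixes A :: "nat \<Rightarrow> nat \<Rightarrow> complex" and w :: "nat \<Rightarrow> real" and n :: nat
  defines "W \<equiv> \<lambda>i j. if i = j then of_real (w i) else 0"
  defines "S \<equiv> \<Sum>i<n. \<Sum>j<n. cmod (A i j - W i j)"
  assumes c: "0 < c" "\<And>i. i < n \<Longrightarrow> c \<le> w i"
    and eq: "\<And>i. i < n \<Longrightarrow> (\<Sum>j<n. A i j * x j) = y i"
    and Y: "\<And>i. i < n \<Longrightarrow> cmod (y i) \<le> Y"
    and small: "S \<le> c / 2"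
    and i: "i < n"
  shows "cmod (of_real (w i) * x i - y i) \<le> 2 * Y / c * S"
proof -
  define X where "X = Max ((\<lambda>i. cmod (x i)) ` {..<n})"
  have X: "cmod (x j) \<le> X" if "j < n" for j
    unfolding X_def using that by (intro Max_ge) auto
  \<comment> \<open>The maximum is attained at some \<open>l\<close>, and row \<open>l\<close> is
    the one where the diagonal term must dominate.\<close>
  have "X \<in> (\<lambda>i. cmod (x i)) ` {..<n}"
    unfolding X_def using i by (intro Max_in) auto
  then obtain l where l: "l < n" "X = cmod (x l)" by auto
  have X0: "X \<ge> 0" using l by simp
  have res: "cmod (of_real (w j) * x j - y j) \<le> S * X" if j: "j < n" for j
  proof -
    have "(\<Sum>k<n. W j k * x k) = of_real (w j) * x j"
      using j by (simp add: W_def if_distrib[of "\<lambda>a. a * _"] cong: if_cong)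
    then have "of_real (w j) * x j - y j = - (\<Sum>k<n. (A j k - W j k) * x k)"
      using eq[OF j] by (simp add: algebra_simps sum_subtractf)
    then have "cmod (of_real (w j) * x j - y j) \<le> (\<Sum>k<n. cmod (A j k - W j k) * cmod (x k))"
      by (simp only: norm_minus_cancel) (rule order.trans[OF norm_sum], simp add: norm_mult)
    also have "\<dots> \<le> (\<Sum>k<n. cmod (A j k - W j k)) * X"
      unfolding sum_distrib_right by (intro sum_mono mult_left_mono X) auto
    also have "\<dots> \<le> S * X"
      unfolding S_def using j X0
      by (intro mult_right_mono member_le_sum[of j "{..<n}" "\<lambda>i. \<Sum>k<n. cmod (A i k - W i k)"])
         (auto intro: sum_nonneg)
    finally show ?thesis .
  qed
  \<comment> \<open>Self-bounding argument: in row \<open>l\<close> the off-diagonal contribution is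
    at most half of \<open>c * X\<close>, hence absorbed by \<open>w l * X\<close>. What remains is
    \<open>X \<le> 2 * Y / c\<close>.\<close>
  have "w l * X = cmod (of_real (w l) * x l)"
    using c(1) c(2)[OF l(1)] l by (simp add: norm_mult)
  also have "\<dots> \<le> cmod (of_real (w l) * x l - y l) + cmod (y l)"
    using norm_triangle_ineq[of "of_real (w l) * x l - y l" "y l"] by simp
  also have "\<dots> \<le> S * X + Y" using res[OF l(1)] Y[OF l(1)] by simp
  also have "\<dots> \<le> c / 2 * X + Y" using mult_right_mono[OF small X0] by simp
  finally have "w l * X \<le> c / 2 * X + Y" .
  moreover have "c * X \<le> w l * X" using c(2)[OF l(1)] X0 by (rule mult_right_mono)
  ultimately have XY: "X \<le> 2 * Y / c" using c(1) by (simp add: field_simps)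
  have "0 \<le> S" unfolding S_def by (intro sum_nonneg) auto
  then have "S * X \<le> S * (2 * Y / c)" using XY by (intro mult_left_mono)
  then show ?thesis using res[OF i] by (simp add: mult.commute)
qed

text \<open>A kernel vector solves the system with right-hand side \<open>0\<close>, so the
  preceding estimate with \<open>Y = 0\<close> annihilates each of its entries.\<close>

lemma near_diagonal_det_nonzero:
  fixes A :: "complex mat" and w :: "nat \<Rightarrow> real"
  assumes A: "A \<in> carrier_mat n n"
    and c: "0 < c" "\<And>i. i < n \<Longrightarrow> c \<le> w i"
    and small: "(\<Sum>i<n. \<Sum>j<n. cmod (A $$ (i, j) - (if i = j then of_real (w i) else 0))) \<le> c / 2"
  shows "det A \<noteq> 0"
proof
  assume "det A = 0"
  then obtain v where v: "v \<in> carrier_vec n" "v \<noteq> 0\<^sub>v n" "A *\<^sub>v v = 0\<^sub>v n"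
    using det_0_iff_vec_prod_zero_field[OF A] by auto
  have eq: "(\<Sum>j<n. A $$ (i, j) * v $ j) = 0" if "i < n" for i
  proof -
    have "(A *\<^sub>v v) $ i = (\<Sum>j<n. A $$ (i, j) * v $ j)"
      using A v(1) that by (subst mult_mat_vec_index) auto
    then show ?thesis using v(3) that by simp
  qed
  have "v $ i = 0" if i: "i < n" for i
  proof -
    have "cmod (of_real (w i) * v $ i - 0) \<le> 2 * 0 / c *
      (\<Sum>i<n. \<Sum>j<n. cmod (A $$ (i, j) - (if i = j then of_real (w i) else 0)))"
      by (rule near_diagonal_solution[OF c eq _ small i]) auto
    then show ?thesis using c(1) c(2)[OF i] by simp
  qed
  then show False using v by auto
qed

text \<open>Column \<open>j\<close> of the inverse solves the system whose right-hand side is the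
  \<open>j\<close>-th unit vector, so \<open>Y = 1\<close> is admissible.\<close>

lemma near_diagonal_minv:
  fixes A :: "complex mat" and w :: "nat \<Rightarrow> real"
  assumes A: "A \<in> carrier_mat n n"
    and c: "0 < c" "\<And>i. i < n \<Longrightarrow> c \<le> w i"
    and small: "(\<Sum>i<n. \<Sum>j<n. cmod (A $$ (i, j) - (if i = j then of_real (w i) else 0))) \<le> c / 2"
    and ij: "i < n" "j < n"
  shows "cmod (of_real (w i) * minv A $$ (i, j) - (if i = j then 1 else 0)) \<le>
    2 / c * (\<Sum>i<n. \<Sum>j<n. cmod (A $$ (i, j) - (if i = j then of_real (w i) else 0)))"
proof -
  have "det A \<noteq> 0" by (rule near_diagonal_det_nonzero[OF A c(1) c(2) small])
  then have inv: "A * minv A = 1\<^sub>m n" by (rule mult_minv[OF A])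
  have eq: "(\<Sum>l<n. A $$ (i, l) * minv A $$ (l, j)) = (if i = j then 1 else 0)" if "i < n" for i
    using arg_cong[OF inv, of "\<lambda>B. B $$ (i, j)"] A minv_carrier[OF A] that ij
    by (subst (asm) mult_mat_index) auto
  have "cmod (of_real (w i) * minv A $$ (i, j) - (if i = j then 1 else 0)) \<le>
    2 * 1 / c * (\<Sum>i<n. \<Sum>j<n. cmod (A $$ (i, j) - (if i = j then of_real (w i) else 0)))"
    by (rule near_diagonal_solution[OF c eq _ small ij(1)]) auto
  then show ?thesis by simp
qed

section \<open>Zero forcing\<close>

text \<open>This is \<open>G^* G\<close> for the matrix \<open>G\<close> with columns
  \<open>h i\<close>, written as sums over antennas because the law of large numbers is applied to
  exactly these sums.\<close>

definition gram :: "nat \<Rightarrow> nat \<Rightarrow> (nat \<Rightarrow> complex vec) \<Rightarrow> complex mat" where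
  "gram M K h = mat K K (\<lambda>(i, j). \<Sum>m<M. cnj (h i $ m) * h j $ m)"

lemma gram_carrier [simp]: "gram M K h \<in> carrier_mat K K"
  by (simp add: gram_def)

lemma gram_eq:
  assumes "\<And>i. i < K \<Longrightarrow> h i \<in> carrier_vec M"
  defines "G \<equiv> mat_of_cols M (map h [0..<K])"
  shows "mat_adjoint G * G = gram M K h"
proof (rule eq_matI)
  fix i j assume "i < dim_row (gram M K h)" "j < dim_col (gram M K h)"
  then have ij: "i < K" "j < K" by (auto simp: gram_def)
  then have "(mat_adjoint G * G) $$ (i, j) = (\<Sum>m<M. mat_adjoint G $$ (i, m) * G $$ (m, j))"
    by (subst mult_mat_index) (auto simp: G_def)
  also have "\<dots> = (\<Sum>m<M. cnj (h i $ m) * h j $ m)"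
    using ij by (intro sum.cong) (auto simp: mat_adjoint_index G_def mat_of_cols_index)
  finally show "(mat_adjoint G * G) $$ (i, j) = gram M K h $$ (i, j)"
    using ij by (simp add: gram_def)
qed (auto simp: G_def gram_def)

lemma zf_detector_eq:
  assumes "\<And>i. i < K \<Longrightarrow> h i \<in> carrier_vec M" and k: "k < K"
  shows "zf_detector M K h k = vec M (\<lambda>m. \<Sum>j<K. h j $ m * minv (gram M K h) $$ (j, k))"
proof -
  define G where "G = mat_of_cols M (map h [0..<K])"
  have mc: "minv (gram M K h) \<in> carrier_mat K K" by (intro minv_carrier) simp
  have zf: "zf_detector M K h k = col (G * minv (gram M K h)) k"
    using gram_eq[OF assms(1)] by (simp add: zf_detector_def Let_def G_def)
  show ?thesis
    unfolding zf
  proof (rule eq_vecI)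
    fix m assume "m < dim_vec (vec M (\<lambda>m. \<Sum>j<K. h j $ m * minv (gram M K h) $$ (j, k)))"
    then have m: "m < M" by simp
    then have "col (G * minv (gram M K h)) k $ m = (G * minv (gram M K h)) $$ (m, k)"
      using k mc by (auto simp: G_def)
    also have "\<dots> = (\<Sum>j<K. G $$ (m, j) * minv (gram M K h) $$ (j, k))"
      using k m mc by (subst mult_mat_index) (auto simp: G_def)
    also have "\<dots> = (\<Sum>j<K. h j $ m * minv (gram M K h) $$ (j, k))"
      using m by (intro sum.cong) (auto simp: G_def mat_of_cols_index)
    finally show "col (G * minv (gram M K h)) k $ m = 
        vec M (\<lambda>m. \<Sum>j<K. h j $ m * minv (gram M K h) $$ (j, k)) $ m" using m by simp
  qed (auto simp: G_def)
qed

lemma zf_detector_zero: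
  assumes "\<And>i. i < K \<Longrightarrow> h i \<in> carrier_vec M" "k < K" "det (gram M K h) = 0"
  shows "zf_detector M K h k = 0\<^sub>v M"
  using assms by (subst zf_detector_eq) (auto simp: minv_singular[OF gram_carrier] intro!: eq_vecI)

text \<open>This is the identity \<open>G^* (G (G^* G)^-1) = 1\<close> read entry by entry.\<close>

lemma zf_detector_orthogonal:
  assumes "\<And>i. i < K \<Longrightarrow> h i \<in> carrier_vec M" "k < K" "det (gram M K h) \<noteq> 0" "i < K"
  shows "(\<Sum>m<M. cnj (h i $ m) * zf_detector M K h k $ m) = (if i = k then 1 else 0)"
proof -
  have mc: "minv (gram M K h) \<in> carrier_mat K K" by (intro minv_carrier) simp
  have "(\<Sum>m<M. cnj (h i $ m) * zf_detector M K h k $ m) =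
      (\<Sum>m<M. \<Sum>j<K. cnj (h i $ m) * h j $ m * minv (gram M K h) $$ (j, k))"
    using assms(1,2) by (intro sum.cong) (auto simp: zf_detector_eq sum_distrib_left mult_ac)
  also have "\<dots> = (\<Sum>j<K. gram M K h $$ (i, j) * minv (gram M K h) $$ (j, k))"
    using assms by (subst sum.swap) (simp add: gram_def sum_distrib_right)
  also have "\<dots> = (gram M K h * minv (gram M K h)) $$ (i, k)"
    using assms mc by (subst mult_mat_index) (auto simp: gram_def)
  also have "\<dots> = (if i = k then 1 else 0)"
    using assms by (simp add: mult_minv[OF gram_carrier])
  finally show ?thesis .
qed

text \<open>The detector is the combination of the \<open>h j\<close> with coefficients from column
  \<open>k\<close> of the inverse. Pairing it with itself and using orthogonality leaves the
  conjugate of coefficient \<open>k\<close> alone. For a singular Gram matrix both sides are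
  zero.\<close>

lemma sq_vnorm_zf_detector:
  assumes h: "\<And>i. i < K \<Longrightarrow> h i \<in> carrier_vec M" and k: "k < K"
  shows "sq_vnorm (zf_detector M K h k) = Re (minv (gram M K h) $$ (k, k))"
proof (cases "det (gram M K h) = 0")
  case True
  then show ?thesis
    using k zf_detector_zero[where h = h, OF h k True] by (simp add: minv_singular[OF gram_carrier] sq_vnorm_def)
next
  case False
  let ?a = "zf_detector M K h k" and ?x = "\<lambda>j. minv (gram M K h) $$ (j, k)"
  have dim: "dim_vec ?a = M" using h k by (simp add: zf_detector_eq)
  have "complex_of_real (sq_vnorm ?a) = (\<Sum>m<M. cnj (?a $ m) * ?a $ m)"
    unfolding sq_vnorm_def dim of_real_sum complex_norm_square by (simp add: mult.commute)
  also have "\<dots> = (\<Sum>m<M. \<Sum>j<K. cnj (?x j) * (cnj (h j $ m) * ?a $ m))"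
  proof (rule sum.cong[OF refl])
    fix m assume "m \<in> {..<M}"
    then have "cnj (?a $ m) = (\<Sum>j<K. cnj (?x j) * cnj (h j $ m))"
      using h k by (simp add: zf_detector_eq mult.commute)
    then show "cnj (?a $ m) * ?a $ m = (\<Sum>j<K. cnj (?x j) * (cnj (h j $ m) * ?a $ m))"
      by (simp add: sum_distrib_right mult.assoc)
  qed
  also have "\<dots> = (\<Sum>j<K. cnj (?x j) * (\<Sum>m<M. cnj (h j $ m) * ?a $ m))"
    by (subst sum.swap) (simp add: sum_distrib_left)
  also have "\<dots> = (\<Sum>j<K. if j = k then cnj (?x j) else 0)"
    using zf_detector_orthogonal[where h = h, OF h k False] by (intro sum.cong) auto
  also have "\<dots> = cnj (?x k)" using k by simp
  finally have "sq_vnorm ?a = Re (cnj (?x k))" by (metis Re_complex_of_real)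
  then show ?thesis by simp
qed

lemma zf_inner:
  assumes h: "\<And>i. i < K \<Longrightarrow> h i \<in> carrier_vec M" and k: "k < K" and i: "i < K"
  shows "cmod (h i \<bullet>c zf_detector M K h k) =
    (if i = k \<and> det (gram M K h) \<noteq> 0 then 1 else 0)"
proof (cases "det (gram M K h) = 0")
  case True
  then show ?thesis using h i by (auto simp: zf_detector_zero[where h = h, OF h k])
next
  case False
  have dim: "dim_vec (zf_detector M K h k) = M" using h k by (simp add: zf_detector_eq)
  have "cnj (h i \<bullet>c zf_detector M K h k) = (\<Sum>m<M. cnj (h i $ m) * zf_detector M K h k $ m)"
    using h[OF i] dim by (simp add: scalar_prod_def atLeast0LessThan)
  also have "\<dots> = (if i = k then 1 else 0)" by (rule zf_detector_orthogonal[where h = h, OF h k False i])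
  finally have "cmod (cnj (h i \<bullet>c zf_detector M K h k)) = (if i = k then 1 else 0)" by simp
  then show ?thesis using False by simp
qed

text \<open>For singular \<open>A\<close> both \<open>minv A\<close> and, since \<open>inverse 0 = 0\<close>, the gain are zero.\<close>

definition zf_gain :: "complex mat \<Rightarrow> nat \<Rightarrow> real" where
  "zf_gain A k = inverse (Re (minv A $$ (k, k)))"

text \<open>Interference vanishes and the signal term is \<open>1\<close>, so dividing through by
  the squared detector norm leaves a factor \<open>zf_gain\<close> and a deterministic denominator.
  For a singular Gram matrix the detector is zero and both sides are \<open>0\<close>.\<close>

lemma sinr_zf_detector:
  assumes h: "\<And>i. i < K \<Longrightarrow> h i \<in> carrier_vec M" and k: "k < K"
  shows "sinr M K pu pp \<beta> p \<alpha> (zf_detector M K h k) h k =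
    pu * zf_gain (gram M K h) k / (pu * (\<Sum>i<K. 1 / real M *
       Re (mat_trace (of_real (\<beta> i) \<cdot>\<^sub>m 1\<^sub>m M - of_real (\<alpha>\<^sup>2) \<cdot>\<^sub>m Theta_mat M pp (\<beta> i) p \<alpha>))) + 1)"
proof (cases "det (gram M K h) = 0")
  case True
  then have "cmod (h k \<bullet>c zf_detector M K h k) = 0"
    using zf_inner[where h = h, OF h k k] by simp
  then show ?thesis
    using k True by (simp add: sinr_def zf_gain_def minv_singular[OF gram_carrier])
next
  case False
  then have "(\<Sum>i\<in>{..<K} - {k}. (cmod (h i \<bullet>c zf_detector M K h k))\<^sup>2) = 0"
    using zf_inner[where h = h, OF h k] by (intro sum.neutral) auto
  then show ?thesis
    using k False zf_inner[where h = h, OF h k k] sq_vnorm_zf_detector[where h = h, OF h k]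
    by (simp add: sinr_def zf_gain_def field_simps)
qed

lemma zf_gain_nonneg:
  assumes h: "\<And>i. i < K \<Longrightarrow> h i \<in> carrier_vec M" and k: "k < K"
  shows "0 \<le> zf_gain (gram M K h) k"
proof -
  have "0 \<le> sq_vnorm (zf_detector M K h k)" by (simp add: sq_vnorm_def sum_nonneg)
  then show ?thesis using sq_vnorm_zf_detector[where h = h, OF h k] by (simp add: zf_gain_def)
qed

text \<open>Cauchy-Schwarz for the pairing of \<open>h k\<close> with its detector, which equals
  \<open>1\<close>: the product of their squared norms is at least \<open>1\<close>. This is the a
  priori bound needed where the Gram matrix is far from diagonal.\<close>

lemma zf_gain_le:
  assumes h: "\<And>i. i < K \<Longrightarrow> h i \<in> carrier_vec M" and k: "k < K"
  shows "zf_gain (gram M K h) k \<le> cmod (gram M K h $$ (k, k))"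
proof (cases "det (gram M K h) = 0")
  case True
  then show ?thesis using k by (simp add: zf_gain_def minv_singular[OF gram_carrier])
next
  case False
  let ?a = "zf_detector M K h k"
  have dim: "dim_vec ?a = M" using h k by (simp add: zf_detector_eq)
  have G: "gram M K h $$ (k, k) = of_real (\<Sum>m<M. (cmod (h k $ m))\<^sup>2)"
    unfolding of_real_sum complex_norm_square using k by (simp add: gram_def mult.commute)
  have "1 = cmod (\<Sum>m<M. cnj (h k $ m) * ?a $ m)"
    using zf_detector_orthogonal[where h = h, OF h k False k] by simp
  also have "\<dots> \<le> (\<Sum>m<M. cmod (h k $ m) * cmod (?a $ m))"
    by (rule order.trans[OF norm_sum]) (simp add: norm_mult)
  finally have "1 \<le> (\<Sum>m<M. cmod (h k $ m) * cmod (?a $ m))\<^sup>2" by simp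
  also have "\<dots> \<le> (\<Sum>m<M. (cmod (h k $ m))\<^sup>2) * sq_vnorm ?a"
    unfolding sq_vnorm_def dim by (rule Cauchy_Schwarz_ineq_sum)
  finally have *: "1 \<le> (\<Sum>m<M. (cmod (h k $ m))\<^sup>2) * sq_vnorm ?a" .
  have "0 \<le> sq_vnorm ?a" by (simp add: sq_vnorm_def sum_nonneg)
  then have "0 < sq_vnorm ?a" using * by (cases "sq_vnorm ?a = 0") auto
  with * have "inverse (sq_vnorm ?a) \<le> (\<Sum>m<M. (cmod (h k $ m))\<^sup>2)"
    by (simp add: field_simps)
  also have "\<dots> = cmod (gram M K h $$ (k, k))"
    unfolding G norm_of_real by (simp add: sum_nonneg)
  finally show ?thesis by (simp add: zf_gain_def sq_vnorm_zf_detector[where h = h, OF h k])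
qed

text \<open>Two cases for the total error \<open>S\<close>, split at \<open>c / 4\<close>. If
  \<open>S\<close> is small, perturbation theory for the inverse gives the constant
  \<open>4 * w k / c\<close>. If \<open>S\<close> is large, the bounds on the gain give at most
  \<open>S + w k\<close>, and \<open>w k\<close> is itself at most \<open>4 * w k / c * S\<close>.
  The stated constant covers both cases, so the estimate holds with no exceptional set.\<close>

lemma zf_gain_near_diagonal:
  fixes w :: "nat \<Rightarrow> real"
  assumes h: "\<And>i. i < K \<Longrightarrow> h i \<in> carrier_vec M" and k: "k < K"
    and s: "0 < s" and c: "0 < c" "\<And>i. i < K \<Longrightarrow> c \<le> w i"
  shows "\<bar>zf_gain (gram M K h) k / s - w k\<bar> \<le> (4 * w k / c + 1) *
    (\<Sum>i<K. \<Sum>j<K. cmod (gram M K h $$ (i, j) / of_real s - (if i = j then of_real (w i) else 0)))"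
proof -
  have wk: "0 < w k" using c(1) c(2)[OF k] by simp
  define S where "S = (\<Sum>i<K. \<Sum>j<K. cmod (gram M K h $$ (i, j) / of_real s - (if i = j then of_real (w i) else 0)))"
  have S0: "0 \<le> S" unfolding S_def by (intro sum_nonneg) auto
  have "\<bar>zf_gain (gram M K h) k / s - w k\<bar> \<le> (4 * w k / c + 1) * S"
  proof (cases "S \<le> c / 4")
    case True
    let ?A = "gram M K h"
    let ?B = "of_real (1 / s) \<cdot>\<^sub>m ?A"
    have B: "?B \<in> carrier_mat K K" by simp
    have BS: "(\<Sum>i<K. \<Sum>j<K. cmod (?B $$ (i, j) - (if i = j then of_real (w i) else 0))) = S"
      unfolding S_def by (intro sum.cong) (auto simp: gram_def)
    have mc: "minv ?A \<in> carrier_mat K K" by (intro minv_carrier gram_carrier)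
    have S2: "S \<le> c / 2" using True c(1) by simp
    have "det ?B \<noteq> 0"
      by (rule near_diagonal_det_nonzero[where w = w, OF B c]) (assumption, unfold BS, rule S2)
    then have det: "det ?A \<noteq> 0" unfolding det_smult by auto
    have "minv ?B = of_real s \<cdot>\<^sub>m minv ?A"
    proof (rule minv_eqI[OF B])
      show "of_real s \<cdot>\<^sub>m minv ?A \<in> carrier_mat K K" using minv_carrier[OF gram_carrier] by simp
      have "?B * (of_real s \<cdot>\<^sub>m minv ?A) = of_real s \<cdot>\<^sub>m (of_real (1 / s) \<cdot>\<^sub>m (?A * minv ?A))"
        by (subst mult_smult_distrib[OF B mc], subst mult_smult_assoc_mat[OF gram_carrier mc]) (rule refl)
      also have "\<dots> = 1\<^sub>m K"
        using s mult_minv[OF gram_carrier det] by (auto intro!: eq_matI)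
      finally show "?B * (of_real s \<cdot>\<^sub>m minv ?A) = 1\<^sub>m K" .
    qed
    then have mB: "minv ?B $$ (k, k) = of_real s * minv ?A $$ (k, k)"
      using minv_carrier[OF gram_carrier, of M K h] k by auto
    \<comment> \<open>\<open>1 / r\<close> is the normalised gain; the task is to compare
      \<open>r\<close> with the inverse of \<open>w k\<close>.\<close>
    define r where "r = s * Re (minv ?A $$ (k, k))"
    have "cmod (of_real (w k) * minv ?B $$ (k, k) - 1) \<le> 2 / c * S"
      using near_diagonal_minv[where w = w and c = c and i = k and j = k, OF B c(1) c(2)] S2 k unfolding BS by simp
    moreover have "\<bar>w k * r - 1\<bar> \<le> cmod (of_real (w k) * minv ?B $$ (k, k) - 1)"
      using abs_Re_le_cmod[of "of_real (w k) * (of_real s * minv ?A $$ (k, k)) - 1"]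
      unfolding mB by (simp add: r_def)
    ultimately have wr: "\<bar>w k * r - 1\<bar> \<le> 2 / c * S" by (rule order.trans[rotated])
    also have "\<dots> \<le> 2 / c * (c / 4)" using True c(1) by (intro mult_left_mono) auto
    also have "\<dots> = 1 / 2" using c(1) by simp
    \<comment> \<open>This is the reason for the threshold \<open>c / 4\<close>: it keeps
      \<open>r\<close> away from \<open>0\<close>, so that \<open>1 / r \<le> 2 * w k\<close> and
      passing to the reciprocal costs only a constant factor.\<close>
    finally have half: "1 / 2 \<le> w k * r" by linarith
    have r: "0 < r" by (rule zero_less_mult_pos[of "w k"]) (use half wk in linarith)+
    have gain: "zf_gain ?A k / s = 1 / r" unfolding zf_gain_def r_def by (simp add: divide_inverse)
    have "\<bar>1 / r - w k\<bar> = \<bar>w k * r - 1\<bar> / r"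
    proof -
      have "1 / r - w k = (1 - w k * r) / r" using r by (simp add: field_simps)
      then show ?thesis using r by (simp add: abs_minus_commute)
    qed
    also have "\<dots> \<le> \<bar>w k * r - 1\<bar> * (2 * w k)"
    proof -
      have "1 / r \<le> 2 * w k" using half r by (simp add: field_simps)
      then show ?thesis using mult_left_mono[of "1 / r" "2 * w k" "\<bar>w k * r - 1\<bar>"] by simp
    qed
    also have "\<dots> \<le> 2 / c * S * (2 * w k)" using wr wk by (intro mult_right_mono) auto
    also have "\<dots> \<le> (4 * w k / c + 1) * S"
      using S0 unfolding distrib_right by (simp add: mult_ac)
    finally show ?thesis unfolding gain .
  next
    case False
    let ?A = "gram M K h"
    have S4: "c / 4 < S" using False by simp
    have g0: "0 \<le> zf_gain ?A k / s" using zf_gain_nonneg[where h = h, OF h k] s by simp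
    have "cmod (?A $$ (k, k) / of_real s - of_real (w k)) \<le>
        (\<Sum>j<K. cmod (?A $$ (k, j) / of_real s - (if k = j then of_real (w k) else 0)))"
      using k member_le_sum[of k "{..<K}" "\<lambda>j. cmod (?A $$ (k, j) / of_real s - (if k = j then of_real (w k) else 0))"]
      by simp
    also have "\<dots> \<le> S"
      unfolding S_def using k by (intro member_le_sum[of k "{..<K}" "\<lambda>i. \<Sum>j<K. cmod (?A $$ (i, j) / of_real s - (if i = j then of_real (w i) else 0))"]) (auto intro: sum_nonneg)
    finally have 1: "cmod (?A $$ (k, k) / of_real s - of_real (w k)) \<le> S" .
    have "zf_gain ?A k / s \<le> cmod (?A $$ (k, k)) / s"
      using zf_gain_le[where h = h, OF h k] s by (simp add: divide_right_mono)
    also have "\<dots> = cmod (?A $$ (k, k) / of_real s)" using s by (simp add: norm_divide)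
    finally have 2: "zf_gain ?A k / s \<le> cmod (?A $$ (k, k) / of_real s)" .
    have 3: "cmod (?A $$ (k, k) / of_real s) \<le> cmod (?A $$ (k, k) / of_real s - of_real (w k)) + w k"
      using norm_triangle_ineq[of "?A $$ (k, k) / of_real s - of_real (w k)" "of_real (w k)"] wk by simp
    have "4 * w k / c * (c / 4) \<le> 4 * w k / c * S"
      by (rule mult_left_mono) (use S4 wk c(1) in auto)
    then have 4: "w k \<le> 4 * w k / c * S" using c(1) by simp
    have "\<bar>zf_gain ?A k / s - w k\<bar> \<le> S + 4 * w k / c * S"
      using 1 2 3 4 g0 wk S0 by linarith
    then show ?thesis unfolding distrib_right by simp
  qed
  then show ?thesis unfolding S_def .
qed

section \<open>The predictor at small pilot power\<close>

text \<open>Quotient and remainder identify the positions of a stacked vector with pairs of block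
  and entry. When \<open>b = 0\<close> both sides are empty sums.\<close>

lemma sum_div_mod:
  fixes f :: "nat \<Rightarrow> nat \<Rightarrow> 'a::comm_monoid_add"
  shows "(\<Sum>k<a * b. f (k div b) (k mod b)) = (\<Sum>i<a. \<Sum>j<b. f i j)"
proof (cases "b = 0")
  case False
  have "(\<Sum>i<a. \<Sum>j<b. f i j) = (\<Sum>i<a. \<Sum>k=i * b..<i * b + b. f (k div b) (k mod b))"
  proof (rule sum.cong[OF refl])
    fix i
    have "(\<Sum>k=i * b..<i * b + b. f (k div b) (k mod b)) = (\<Sum>j=0..<b. f ((j + i * b) div b) ((j + i * b) mod b))"
      using sum.shift_bounds_nat_ivl[of "\<lambda>k. f (k div b) (k mod b)" 0 "i * b" b] by (simp add: add.commute)
    also have "\<dots> = (\<Sum>j<b. f i j)" using False by (intro sum.cong) auto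
    finally show "(\<Sum>j<b. f i j) = (\<Sum>k=i * b..<i * b + b. f (k div b) (k mod b))" by simp
  qed
  also have "\<dots> = (\<Sum>k<a * b. f (k div b) (k mod b))" by (rule sum.nat_group)
  finally show ?thesis by simp
qed simp

section \<open>Kronecker products\<close>

lemma kron_dim [simp]:
  "dim_row (A \<otimes>\<^sub>K B) = dim_row A * dim_row B" "dim_col (A \<otimes>\<^sub>K B) = dim_col A * dim_col B"
  by (simp_all add: kron_def)

lemma kron_carrier:
  assumes "A \<in> carrier_mat a b" "B \<in> carrier_mat c d"
  shows "A \<otimes>\<^sub>K B \<in> carrier_mat (a * c) (b * d)"
  using assms by auto

lemma kron_index:
  assumes "i < dim_row A * dim_row B" "j < dim_col A * dim_col B"
  shows "(A \<otimes>\<^sub>K B) $$ (i, j) = A $$ (i div dim_row B, j div dim_col B) * B $$ (i mod dim_row B, j mod dim_col B)"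
  using assms by (simp add: kron_def)

lemma div_mod_less:
  fixes i :: nat
  assumes "i < a * b"
  shows "i div b < a" "i mod b < b"
  using assms by (auto simp: less_mult_imp_div_less) (metis mod_less_divisor mult_0_right not_gr_zero not_less_zero)

text \<open>Splitting the summation index into quotient and remainder turns the sum into a product
  of two sums. This mixed-product rule carries every later reduction from size
  \<open>M * (p + 1)\<close> to size \<open>p + 1\<close>.\<close>

lemma kron_mult:
  fixes A B C D :: "'a::comm_semiring_0 mat"
  assumes "dim_col A = dim_row C" "dim_col B = dim_row D"
  shows "(A \<otimes>\<^sub>K B) * (C \<otimes>\<^sub>K D) = (A * C) \<otimes>\<^sub>K (B * D)"
proof (rule eq_matI)
  fix i j assume "i < dim_row ((A * C) \<otimes>\<^sub>K (B * D))" "j < dim_col ((A * C) \<otimes>\<^sub>K (B * D))"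
  then have ij: "i < dim_row A * dim_row B" "j < dim_col C * dim_col D" by auto
  note im = div_mod_less[OF ij(1)] div_mod_less[OF ij(2)]
  let ?i1 = "i div dim_row B" and ?i2 = "i mod dim_row B" and ?j1 = "j div dim_col D" and ?j2 = "j mod dim_col D"
  have "((A \<otimes>\<^sub>K B) * (C \<otimes>\<^sub>K D)) $$ (i, j) =
      (\<Sum>k<dim_row C * dim_row D. (A $$ (?i1, k div dim_row D) * B $$ (?i2, k mod dim_row D)) *
        (C $$ (k div dim_row D, ?j1) * D $$ (k mod dim_row D, ?j2)))"
    using ij assms by (subst mult_mat_index) (auto simp: kron_index)
  also have "\<dots> = (\<Sum>l<dim_row C. \<Sum>m<dim_row D. (A $$ (?i1, l) * B $$ (?i2, m)) * (C $$ (l, ?j1) * D $$ (m, ?j2)))"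
    by (rule sum_div_mod)
  also have "\<dots> = (\<Sum>l<dim_row C. A $$ (?i1, l) * C $$ (l, ?j1)) * (\<Sum>m<dim_row D. B $$ (?i2, m) * D $$ (m, ?j2))"
    by (simp add: sum_product mult_ac)
  also have "\<dots> = (A * C) $$ (?i1, ?j1) * (B * D) $$ (?i2, ?j2)"
    using im assms by (subst (1 2) mult_mat_index) auto
  also have "\<dots> = ((A * C) \<otimes>\<^sub>K (B * D)) $$ (i, j)" using ij by (subst kron_index) auto
  finally show "((A \<otimes>\<^sub>K B) * (C \<otimes>\<^sub>K D)) $$ (i, j) = ((A * C) \<otimes>\<^sub>K (B * D)) $$ (i, j)" .
qed auto

lemma kron_add_left:
  assumes "A \<in> carrier_mat a b" "B \<in> carrier_mat a b" "C \<in> carrier_mat c d"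
  shows "(A + B) \<otimes>\<^sub>K C = A \<otimes>\<^sub>K C + B \<otimes>\<^sub>K (C :: 'a::semiring_0 mat)"
proof (rule eq_matI)
  fix i j assume "i < dim_row (A \<otimes>\<^sub>K C + B \<otimes>\<^sub>K C)" "j < dim_col (A \<otimes>\<^sub>K C + B \<otimes>\<^sub>K C)"
  then have ij: "i < a * c" "j < b * d" using assms by auto
  show "((A + B) \<otimes>\<^sub>K C) $$ (i, j) = (A \<otimes>\<^sub>K C + B \<otimes>\<^sub>K C) $$ (i, j)"
    using ij div_mod_less[OF ij(1)] div_mod_less[OF ij(2)] assms by (simp add: kron_index distrib_right)
qed (use assms in auto)

lemma kron_smult_left: "(x \<cdot>\<^sub>m A) \<otimes>\<^sub>K B = x \<cdot>\<^sub>m (A \<otimes>\<^sub>K (B :: 'a::semiring_0 mat))"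
proof (rule eq_matI)
  fix i j assume "i < dim_row (x \<cdot>\<^sub>m (A \<otimes>\<^sub>K B))" "j < dim_col (x \<cdot>\<^sub>m (A \<otimes>\<^sub>K B))"
  then have ij: "i < dim_row A * dim_row B" "j < dim_col A * dim_col B" by auto
  show "((x \<cdot>\<^sub>m A) \<otimes>\<^sub>K B) $$ (i, j) = (x \<cdot>\<^sub>m (A \<otimes>\<^sub>K B)) $$ (i, j)"
    using ij div_mod_less[OF ij(1)] div_mod_less[OF ij(2)] by (simp add: kron_index mult.assoc)
qed auto

lemma kron_one: "1\<^sub>m a \<otimes>\<^sub>K 1\<^sub>m b = (1\<^sub>m (a * b) :: 'a::semiring_1 mat)"
proof (rule eq_matI)
  fix i j assume "i < dim_row (1\<^sub>m (a * b) :: 'a mat)" "j < dim_col (1\<^sub>m (a * b) :: 'a mat)"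
  then have ij: "i < a * b" "j < a * b" by auto
  have "i = j \<longleftrightarrow> i div b = j div b \<and> i mod b = j mod b"
    by (metis div_mult_mod_eq)
  then show "(1\<^sub>m a \<otimes>\<^sub>K 1\<^sub>m b) $$ (i, j) = (1\<^sub>m (a * b) :: 'a mat) $$ (i, j)"
    using ij div_mod_less[OF ij(1)] div_mod_less[OF ij(2)] by (simp add: kron_index)
qed auto

text \<open>The matrix \<open>T\<close>, freed of the Kronecker factor and scaled by the pilot power, is a perturbation
  of the identity for small pilot power.\<close>

definition scaled_cov :: "real \<Rightarrow> real \<Rightarrow> nat \<Rightarrow> real \<Rightarrow> complex mat" where
  "scaled_cov pp \<beta> p \<alpha> = of_real (pp * \<beta>) \<cdot>\<^sub>m Delta_mat p \<alpha> + 1\<^sub>m (p + 1)"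

lemma Delta_mat_carrier: "Delta_mat p \<alpha> \<in> carrier_mat (p + 1) (p + 1)"
  by (simp add: Delta_mat_def)

lemma delta_row_carrier: "delta_row p \<alpha> \<in> carrier_mat 1 (p + 1)"
  by (simp add: delta_row_def)

lemma scaled_cov_carrier: "scaled_cov pp \<beta> p \<alpha> \<in> carrier_mat (p + 1) (p + 1)"
  by (simp add: scaled_cov_def Delta_mat_def)

text \<open>The simplifier rewrites \<open>p + 1\<close> to \<open>Suc p\<close>, so the carrier
  facts are stored in that form. Removing \<open>sum.lessThan_Suc\<close> keeps it from splitting
  the last term off sums over the predictor taps.\<close>

declare Delta_mat_carrier [simplified, simp] delta_row_carrier [simplified, simp]
  scaled_cov_carrier [simplified, simp]
declare sum.lessThan_Suc [simp del]

lemma T_mat_eq_kron: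
  assumes pp: "0 < pp"
  shows "T_mat M pp \<beta> p \<alpha> = (of_real (1 / pp) \<cdot>\<^sub>m scaled_cov pp \<beta> p \<alpha>) \<otimes>\<^sub>K 1\<^sub>m M"
proof -
  have "of_real (1 / pp) \<cdot>\<^sub>m scaled_cov pp \<beta> p \<alpha> =
      of_real \<beta> \<cdot>\<^sub>m Delta_mat p \<alpha> + of_real (1 / pp) \<cdot>\<^sub>m 1\<^sub>m (p + 1)"
    using pp by (intro eq_matI) (auto simp: scaled_cov_def Delta_mat_def field_simps)
  moreover have "(of_real \<beta> \<cdot>\<^sub>m Delta_mat p \<alpha> + of_real (1 / pp) \<cdot>\<^sub>m 1\<^sub>m (p + 1)) \<otimes>\<^sub>K 1\<^sub>m M =
      (of_real \<beta> \<cdot>\<^sub>m Delta_mat p \<alpha>) \<otimes>\<^sub>K 1\<^sub>m M + (of_real (1 / pp) \<cdot>\<^sub>m 1\<^sub>m (p + 1)) \<otimes>\<^sub>K (1\<^sub>m M :: complex mat)"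
    by (rule kron_add_left[OF smult_carrier_mat[OF Delta_mat_carrier] smult_carrier_mat[OF one_carrier_mat] one_carrier_mat])
  ultimately show ?thesis
    by (simp only: T_mat_def kron_smult_left kron_one mult.commute[of M])
qed

text \<open>The mixed-product rule inverts each factor separately. The remaining inverse has size
  \<open>p + 1\<close>, independent of the number of antennas, so its limit for vanishing pilot
  power can be taken entrywise.\<close>

lemma minv_T_mat:
  assumes pp: "0 < pp" and det: "det (scaled_cov pp \<beta> p \<alpha>) \<noteq> 0"
  shows "minv (T_mat M pp \<beta> p \<alpha>) = (of_real pp \<cdot>\<^sub>m minv (scaled_cov pp \<beta> p \<alpha>)) \<otimes>\<^sub>K 1\<^sub>m M"
proof -
  let ?U = "scaled_cov pp \<beta> p \<alpha>" and ?n = "p + 1"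
  have mU: "minv ?U \<in> carrier_mat ?n ?n" by (intro minv_carrier scaled_cov_carrier)
  show ?thesis
    unfolding T_mat_eq_kron[OF pp]
  proof (rule minv_eqI[where n = "?n * M"])
    show "(of_real (1 / pp) \<cdot>\<^sub>m ?U) \<otimes>\<^sub>K 1\<^sub>m M \<in> carrier_mat (?n * M) (?n * M)"
      by (intro kron_carrier smult_carrier_mat scaled_cov_carrier one_carrier_mat)
    show "(of_real pp \<cdot>\<^sub>m minv ?U) \<otimes>\<^sub>K 1\<^sub>m M \<in> carrier_mat (?n * M) (?n * M)"
      by (intro kron_carrier smult_carrier_mat mU one_carrier_mat)
    have "(of_real (1 / pp) \<cdot>\<^sub>m ?U) * (of_real pp \<cdot>\<^sub>m minv ?U) = of_real pp \<cdot>\<^sub>m (of_real (1 / pp) \<cdot>\<^sub>m (?U * minv ?U))"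
      by (subst mult_smult_distrib[OF smult_carrier_mat[OF scaled_cov_carrier] mU],
          subst mult_smult_assoc_mat[OF scaled_cov_carrier mU]) (rule refl)
    also have "\<dots> = 1\<^sub>m ?n"
      unfolding mult_minv[OF scaled_cov_carrier det] using pp by (intro eq_matI) auto
    finally have *: "(of_real (1 / pp) \<cdot>\<^sub>m ?U) * (of_real pp \<cdot>\<^sub>m minv ?U) = 1\<^sub>m ?n" .
    have "((of_real (1 / pp) \<cdot>\<^sub>m ?U) \<otimes>\<^sub>K 1\<^sub>m M) * ((of_real pp \<cdot>\<^sub>m minv ?U) \<otimes>\<^sub>K 1\<^sub>m M) =
        1\<^sub>m ?n \<otimes>\<^sub>K (1\<^sub>m M * 1\<^sub>m M)"
      unfolding *[symmetric]
      by (intro kron_mult) (simp_all add: carrier_matD[OF mU] carrier_matD[OF scaled_cov_carrier])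
    then show "((of_real (1 / pp) \<cdot>\<^sub>m ?U) \<otimes>\<^sub>K 1\<^sub>m M) * ((of_real pp \<cdot>\<^sub>m minv ?U) \<otimes>\<^sub>K 1\<^sub>m M) = 1\<^sub>m (?n * M)"
      by (simp add: kron_one del: mult_Suc)
  qed
qed

text \<open>The predictor matrix is \<open>pp\<close> times the row of these coefficients, tensored
  with the identity. Keeping \<open>pp\<close> outside leaves coefficients with a finite nonzero
  limit when \<open>\<alpha>\<close> and \<open>\<beta>\<close> are nonzero.\<close>

definition pred_coeff :: "real \<Rightarrow> real \<Rightarrow> nat \<Rightarrow> real \<Rightarrow> nat \<Rightarrow> complex" where
  "pred_coeff pp \<beta> p \<alpha> j =
     of_real (\<alpha> * \<beta>) * (\<Sum>l<p + 1. of_real (\<alpha> ^ l) * minv (scaled_cov pp \<beta> p \<alpha>) $$ (l, j))"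

text \<open>Through the identity factor only stacked positions with \<open>i mod M = m\<close>
  contribute to entry \<open>m\<close>, so the predictor acts on every antenna by the same filter
  with \<open>p + 1\<close> taps.\<close>

lemma predicted_channel_index:
  assumes pp: "0 < pp" and det: "det (scaled_cov pp \<beta> p \<alpha>) \<noteq> 0" and m: "m < M"
  shows "predicted_channel M pp \<beta> p \<alpha> g b n \<omega> $ m =
    of_real pp * (\<Sum>j<p + 1. pred_coeff pp \<beta> p \<alpha> j * observation pp g b (n - int j) m \<omega>)"
proof -
  let ?U = "scaled_cov pp \<beta> p \<alpha>" and ?n = "p + 1"
  have mU: "minv ?U \<in> carrier_mat ?n ?n" by (intro minv_carrier scaled_cov_carrier)
  let ?V = "of_real (\<alpha> * \<beta>) \<cdot>\<^sub>m (delta_row p \<alpha> * (of_real pp \<cdot>\<^sub>m minv ?U))"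
  have V: "?V \<in> carrier_mat 1 ?n" using mU by (auto simp: delta_row_def)
  have "(delta_row p \<alpha> \<otimes>\<^sub>K 1\<^sub>m M) * ((of_real pp \<cdot>\<^sub>m minv ?U) \<otimes>\<^sub>K 1\<^sub>m M) =
      (delta_row p \<alpha> * (of_real pp \<cdot>\<^sub>m minv ?U)) \<otimes>\<^sub>K (1\<^sub>m M * 1\<^sub>m M)"
    using mU by (intro kron_mult) (auto simp: delta_row_def)
  then have q: "q_mat M pp \<beta> p \<alpha> = ?V \<otimes>\<^sub>K 1\<^sub>m M"
    by (simp add: q_mat_def minv_T_mat[OF pp det] kron_smult_left)
  have Vc: "?V $$ (0, j) = of_real pp * pred_coeff pp \<beta> p \<alpha> j" if "j < ?n" for j
  proof -
    have "(delta_row p \<alpha> * (of_real pp \<cdot>\<^sub>m minv ?U)) $$ (0, j) =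
        (\<Sum>l<?n. of_real (\<alpha> ^ l) * (of_real pp * minv ?U $$ (l, j)))"
      using mU that by (subst mult_mat_index) (auto simp: delta_row_def intro!: sum.cong)
    then show ?thesis
      using mU that by (simp add: delta_row_def pred_coeff_def sum_distrib_left mult_ac)
  qed
  let ?y = "\<lambda>j m'. observation pp g b (n - int j) m' \<omega>"
  have "predicted_channel M pp \<beta> p \<alpha> g b n \<omega> $ m =
      (\<Sum>i<?n * M. (?V \<otimes>\<^sub>K 1\<^sub>m M) $$ (m, i) * ?y (i div M) (i mod M))"
    unfolding predicted_channel_def q stacked_observation_def mult.commute[of M "?n"]
    by (subst mult_mat_vec_index) (use carrier_matD[OF V] m in \<open>auto intro!: sum.cong\<close>)
  also have "\<dots> = (\<Sum>i<?n * M. ?V $$ (0, i div M) * (if m = i mod M then 1 else 0) * ?y (i div M) (i mod M))"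
  proof (rule sum.cong[OF refl])
    fix i assume "i \<in> {..<?n * M}"
    then have i: "i < ?n * M" by simp
    have "(?V \<otimes>\<^sub>K 1\<^sub>m M) $$ (m, i) = ?V $$ (m div M, i div M) * 1\<^sub>m M $$ (m mod M, i mod M)"
      using m i V by (subst kron_index) auto
    then show "(?V \<otimes>\<^sub>K 1\<^sub>m M) $$ (m, i) * ?y (i div M) (i mod M) =
        ?V $$ (0, i div M) * (if m = i mod M then 1 else 0) * ?y (i div M) (i mod M)"
      using m div_mod_less[OF i] by simp
  qed
  also have "\<dots> = (\<Sum>j<?n. \<Sum>m'<M. ?V $$ (0, j) * (if m = m' then 1 else 0) * ?y j m')"
    by (rule sum_div_mod)
  also have "\<dots> = (\<Sum>j<?n. \<Sum>m'<M. if m = m' then ?V $$ (0, j) * ?y j m' else 0)"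
    by (intro sum.cong) auto
  also have "\<dots> = (\<Sum>j<?n. ?V $$ (0, j) * ?y j m)"
    using m by simp
  also have "\<dots> = of_real pp * (\<Sum>j<?n. pred_coeff pp \<beta> p \<alpha> j * ?y j m)"
    unfolding sum_distrib_left by (intro sum.cong) (simp_all only: Vc lessThan_iff mult.assoc)
  finally show ?thesis .
qed

lemma predicted_channel_dim: "dim_vec (predicted_channel M pp \<beta> p \<alpha> g b n \<omega>) = M"
  by (simp add: predicted_channel_def q_mat_def delta_row_def)

text \<open>The common diagonal entry of \<open>Theta_mat\<close>, namely the quadratic form of the
  inverse covariance at the row \<open>delta_row\<close>; the adjoint is a plain transpose since the
  row is real.\<close>

definition pred_var :: "real \<Rightarrow> real \<Rightarrow> nat \<Rightarrow> real \<Rightarrow> complex" where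
  "pred_var pp \<beta> p \<alpha> = of_real (\<beta>\<^sup>2 * pp) *
     (\<Sum>i<p + 1. \<Sum>j<p + 1. of_real (\<alpha> ^ i) * minv (scaled_cov pp \<beta> p \<alpha>) $$ (i, j) * of_real (\<alpha> ^ j))"

text \<open>\<open>Theta_mat\<close> is a one-by-one matrix tensored with the identity, hence a
  scalar matrix, and averaging its trace over antennas returns that scalar.\<close>

lemma trace_error:
  assumes pp: "0 < pp" and det: "det (scaled_cov pp \<beta> p \<alpha>) \<noteq> 0" and M: "0 < M"
  shows "1 / real M * Re (mat_trace (of_real \<beta> \<cdot>\<^sub>m 1\<^sub>m M - of_real (\<alpha>\<^sup>2) \<cdot>\<^sub>m Theta_mat M pp \<beta> p \<alpha>)) =
    \<beta> - \<alpha>\<^sup>2 * Re (pred_var pp \<beta> p \<alpha>)"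
proof -
  let ?U = "scaled_cov pp \<beta> p \<alpha>" and ?n = "p + 1"
  have mU: "minv ?U \<in> carrier_mat ?n ?n" by (intro minv_carrier scaled_cov_carrier)
  let ?V = "delta_row p \<alpha> * (of_real pp \<cdot>\<^sub>m minv ?U)"
  have V: "?V \<in> carrier_mat 1 ?n" using mU by (auto simp: delta_row_def)
  have "(delta_row p \<alpha> \<otimes>\<^sub>K 1\<^sub>m M) * ((of_real pp \<cdot>\<^sub>m minv ?U) \<otimes>\<^sub>K 1\<^sub>m M) = ?V \<otimes>\<^sub>K (1\<^sub>m M * 1\<^sub>m M)"
    using mU by (intro kron_mult) (auto simp: delta_row_def)
  moreover have "mat_adjoint (delta_row p \<alpha> \<otimes>\<^sub>K 1\<^sub>m M) = mat_adjoint (delta_row p \<alpha>) \<otimes>\<^sub>K 1\<^sub>m M"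
  proof (rule eq_matI)
    fix i j assume "i < dim_row (mat_adjoint (delta_row p \<alpha>) \<otimes>\<^sub>K 1\<^sub>m M)" "j < dim_col (mat_adjoint (delta_row p \<alpha>) \<otimes>\<^sub>K 1\<^sub>m M)"
    then have ij: "i < ?n * M" "j < 1 * M" by (auto simp: delta_row_def)
    then show "mat_adjoint (delta_row p \<alpha> \<otimes>\<^sub>K 1\<^sub>m M) $$ (i, j) = (mat_adjoint (delta_row p \<alpha>) \<otimes>\<^sub>K 1\<^sub>m M) $$ (i, j)"
      using div_mod_less[OF ij(1)]
      by (simp add: mat_adjoint_index kron_index delta_row_def)
  qed auto
  moreover have "(?V \<otimes>\<^sub>K 1\<^sub>m M) * (mat_adjoint (delta_row p \<alpha>) \<otimes>\<^sub>K 1\<^sub>m M) =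
      (?V * mat_adjoint (delta_row p \<alpha>)) \<otimes>\<^sub>K (1\<^sub>m M * 1\<^sub>m M)"
    using V by (intro kron_mult) (auto simp: delta_row_def)
  ultimately have Th: "Theta_mat M pp \<beta> p \<alpha> = of_real (\<beta>\<^sup>2) \<cdot>\<^sub>m ((?V * mat_adjoint (delta_row p \<alpha>)) \<otimes>\<^sub>K 1\<^sub>m M)"
    by (simp add: Theta_mat_def minv_T_mat[OF pp det])
  have Vc: "?V $$ (0, j) = (\<Sum>i<?n. of_real (\<alpha> ^ i) * (of_real pp * minv ?U $$ (i, j)))" if "j < ?n" for j
    using mU that by (subst mult_mat_index) (auto simp: delta_row_def intro!: sum.cong)
  have "(?V * mat_adjoint (delta_row p \<alpha>)) $$ (0, 0) = (\<Sum>j<?n. ?V $$ (0, j) * of_real (\<alpha> ^ j))"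
    using V by (subst mult_mat_index) (auto simp: mat_adjoint_index delta_row_def intro!: sum.cong)
  also have "\<dots> = (\<Sum>j<?n. \<Sum>i<?n. of_real (\<alpha> ^ i) * (of_real pp * minv ?U $$ (i, j)) * of_real (\<alpha> ^ j))"
    by (intro sum.cong) (simp_all add: Vc sum_distrib_right del: index_mult_mat)
  also have "\<dots> = (\<Sum>i<?n. \<Sum>j<?n. of_real (\<alpha> ^ i) * (of_real pp * minv ?U $$ (i, j)) * of_real (\<alpha> ^ j))"
    by (rule sum.swap)
  finally have V0: "of_real (\<beta>\<^sup>2) * (?V * mat_adjoint (delta_row p \<alpha>)) $$ (0, 0) = pred_var pp \<beta> p \<alpha>"
    by (simp add: pred_var_def sum_distrib_left mult_ac)
  have dT: "dim_row (Theta_mat M pp \<beta> p \<alpha>) = M" "dim_col (Theta_mat M pp \<beta> p \<alpha>) = M"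
    unfolding Th by (auto simp: delta_row_def)
  have Thi: "Theta_mat M pp \<beta> p \<alpha> $$ (i, i) = pred_var pp \<beta> p \<alpha>" if i: "i < M" for i
  proof -
    have "((?V * mat_adjoint (delta_row p \<alpha>)) \<otimes>\<^sub>K 1\<^sub>m M) $$ (i, i) = (?V * mat_adjoint (delta_row p \<alpha>)) $$ (0, 0)"
      using i by (subst kron_index) (auto simp: delta_row_def)
    then show ?thesis unfolding Th using i V0 by (subst index_smult_mat) (auto simp: delta_row_def)
  qed
  have "mat_trace (of_real \<beta> \<cdot>\<^sub>m 1\<^sub>m M - of_real (\<alpha>\<^sup>2) \<cdot>\<^sub>m Theta_mat M pp \<beta> p \<alpha>) =
      (\<Sum>i<M. of_real \<beta> - of_real (\<alpha>\<^sup>2) * pred_var pp \<beta> p \<alpha>)"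
    unfolding mat_trace_def using dT by (intro sum.cong) (auto simp: Thi)
  then have "Re (mat_trace (of_real \<beta> \<cdot>\<^sub>m 1\<^sub>m M - of_real (\<alpha>\<^sup>2) \<cdot>\<^sub>m Theta_mat M pp \<beta> p \<alpha>)) =
      real M * (\<beta> - \<alpha>\<^sup>2 * Re (pred_var pp \<beta> p \<alpha>))"
    by (simp del: of_real_power)
  then show ?thesis using M by simp
qed

text \<open>The deviation from the identity is \<open>f x\<close> times a fixed matrix, so its total
  size is linear in \<open>\<bar>f x\<bar>\<close> and eventually below \<open>1 / 2\<close>. The
  near-diagonal estimates then apply with \<open>c = 1\<close> and all
  \<open>w i = 1\<close>.\<close>

lemma scaled_cov_limit:
  assumes f: "(f \<longlongrightarrow> (0::real)) F"
  shows "\<forall>\<^sub>F x in F. det (scaled_cov (f x) \<beta> p \<alpha>) \<noteq> 0"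
    "\<And>i j. i < p + 1 \<Longrightarrow> j < p + 1 \<Longrightarrow>
      ((\<lambda>x. minv (scaled_cov (f x) \<beta> p \<alpha>) $$ (i, j)) \<longlongrightarrow> (if i = j then 1 else 0)) F"
proof -
  let ?n = "p + 1"
  define S where "S x = (\<Sum>i<?n. \<Sum>j<?n. cmod (scaled_cov (f x) \<beta> p \<alpha> $$ (i, j) - (if i = j then of_real 1 else 0)))" for x
  have S: "S x = \<bar>f x\<bar> * (\<Sum>i<?n. \<Sum>j<?n. \<bar>\<beta>\<bar> * cmod (Delta_mat p \<alpha> $$ (i, j)))" for x
    unfolding S_def sum_distrib_left
    by (intro sum.cong refl) (auto simp: scaled_cov_def Delta_mat_def norm_mult abs_mult simp del: of_real_mult simp flip: of_real_mult)
  have S0: "(S \<longlongrightarrow> 0) F"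
    unfolding S using f by (intro tendsto_mult_left_zero tendsto_rabs_zero)
  then have small: "\<forall>\<^sub>F x in F. S x \<le> 1 / 2"
    by (auto dest!: order_tendstoD(2)[of _ _ _ "1/2"] elim!: eventually_mono)
  then show "\<forall>\<^sub>F x in F. det (scaled_cov (f x) \<beta> p \<alpha>) \<noteq> 0"
    by (rule eventually_mono)
       (rule near_diagonal_det_nonzero[OF scaled_cov_carrier, where c = 1 and w = "\<lambda>_. 1"], auto simp: S_def)
  show "((\<lambda>x. minv (scaled_cov (f x) \<beta> p \<alpha>) $$ (i, j)) \<longlongrightarrow> (if i = j then 1 else 0)) F"
    if ij: "i < ?n" "j < ?n" for i j
  proof (rule Lim_null[THEN iffD2], rule Lim_null_comparison)
    show "\<forall>\<^sub>F x in F. norm (minv (scaled_cov (f x) \<beta> p \<alpha>) $$ (i, j) - (if i = j then 1 else 0)) \<le> 2 * S x"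
      using small
    proof (rule eventually_mono)
      fix x assume "S x \<le> 1 / 2"
      then show "norm (minv (scaled_cov (f x) \<beta> p \<alpha>) $$ (i, j) - (if i = j then 1 else 0)) \<le> 2 * S x"
        using near_diagonal_minv[OF scaled_cov_carrier[of "f x" \<beta> p \<alpha>], where c = 1 and w = "\<lambda>_. 1" and i = i and j = j] ij
        by (simp add: S_def)
    qed
    show "((\<lambda>x. 2 * S x) \<longlongrightarrow> 0) F" using S0 by (rule tendsto_mult_right_zero)
  qed
qed

lemma pred_coeff_limit:
  assumes f: "(f \<longlongrightarrow> 0) F" and j: "j < p + 1"
  shows "((\<lambda>x. pred_coeff (f x) \<beta> p \<alpha> j) \<longlongrightarrow> of_real (\<alpha> * \<beta> * \<alpha> ^ j)) F"
proof -
  have "((\<lambda>x. pred_coeff (f x) \<beta> p \<alpha> j) \<longlongrightarrow>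
      of_real (\<alpha> * \<beta>) * (\<Sum>l<p + 1. of_real (\<alpha> ^ l) * (if l = j then 1 else 0))) F"
    unfolding pred_coeff_def using f j by (intro tendsto_intros scaled_cov_limit(2)) auto
  also have "(\<Sum>l<p + 1. of_real (\<alpha> ^ l) * (if l = j then 1 else 0)) = (\<Sum>l<p + 1. if l = j then complex_of_real (\<alpha> ^ j) else 0)"
    by (intro sum.cong) auto
  also have "of_real (\<alpha> * \<beta>) * (\<Sum>l<p + 1. if l = j then complex_of_real (\<alpha> ^ j) else 0) = of_real (\<alpha> * \<beta> * \<alpha> ^ j)"
    using j by simp
  finally show ?thesis .
qed

text \<open>The explicit factor \<open>pp\<close> meets a convergent double sum. Prediction thus
  becomes useless as an estimate, the error variance tending to \<open>\<beta>\<close>, but in the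
  SINR this variance is multiplied by \<open>pu\<close> and so disappears.\<close>

lemma pred_var_limit:
  assumes f: "(f \<longlongrightarrow> 0) F"
  shows "((\<lambda>x. pred_var (f x) \<beta> p \<alpha>) \<longlongrightarrow> 0) F"
proof -
  have "((\<lambda>x. pred_var (f x) \<beta> p \<alpha>) \<longlongrightarrow> of_real (\<beta>\<^sup>2 * 0) *
      (\<Sum>i<p + 1. \<Sum>j<p + 1. of_real (\<alpha> ^ i) * (if i = j then 1 else 0) * of_real (\<alpha> ^ j))) F"
    unfolding pred_var_def using f by (intro tendsto_intros scaled_cov_limit(2)) auto
  then show ?thesis by simp
qed

section \<open>Moments and empirical correlations\<close>

abbreviation std_gauss :: "real measure" where
  "std_gauss \<equiv> density lborel std_normal_density"

lemma prob_space_std_gauss: "prob_space std_gauss"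
  by (rule prob_space_normal_density) simp

lemma std_gauss_power:
  "integrable std_gauss (\<lambda>x. x ^ j)"
  "integral\<^sup>L std_gauss (\<lambda>x. x ^ j) = integral\<^sup>L lborel (\<lambda>x. std_normal_density x * x ^ j)"
  by (simp_all add: integrable_density integral_density integrable_std_normal_moment)

lemma std_gauss_moments:
  "integral\<^sup>L std_gauss (\<lambda>x. x) = 0" "integral\<^sup>L std_gauss (\<lambda>x. x\<^sup>2) = 1"
  using std_gauss_power(2)[of 1] integral_std_normal_moment_odd[of 0]
    std_gauss_power(2)[of 2] integral_std_normal_moment_even[of 1]
  by simp_all

lemma std_gauss_pair:
  fixes f :: "real \<Rightarrow> 'b::{banach, second_countable_topology}"
  assumes f: "integrable std_gauss f"
  shows "integrable (std_gauss \<Otimes>\<^sub>M std_gauss) (\<lambda>z. f (fst z))"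
    "integral\<^sup>L (std_gauss \<Otimes>\<^sub>M std_gauss) (\<lambda>z. f (fst z)) = integral\<^sup>L std_gauss f"
    "integrable (std_gauss \<Otimes>\<^sub>M std_gauss) (\<lambda>z. f (snd z))"
    "integral\<^sup>L (std_gauss \<Otimes>\<^sub>M std_gauss) (\<lambda>z. f (snd z)) = integral\<^sup>L std_gauss f"
proof -
  interpret prob_space std_gauss by (rule prob_space_std_gauss)
  interpret pair_sigma_finite std_gauss std_gauss ..
  have fm: "f \<in> borel_measurable std_gauss" using f by (rule borel_measurable_integrable)
  have fst: "distr (std_gauss \<Otimes>\<^sub>M std_gauss) std_gauss fst = std_gauss" by (rule distr_pair_fst)
  have snd: "distr (std_gauss \<Otimes>\<^sub>M std_gauss) std_gauss snd = std_gauss"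
  proof -
    have "distr (std_gauss \<Otimes>\<^sub>M std_gauss) std_gauss snd =
        distr (distr (std_gauss \<Otimes>\<^sub>M std_gauss) (std_gauss \<Otimes>\<^sub>M std_gauss) (\<lambda>(x, y). (y, x))) std_gauss snd"
      by (subst distr_pair_swap) (rule refl)
    also have "\<dots> = distr (std_gauss \<Otimes>\<^sub>M std_gauss) std_gauss (snd \<circ> (\<lambda>(x, y). (y, x)))"
      by (rule distr_distr) simp_all
    also have "snd \<circ> (\<lambda>(x, y). (y, x)) = (fst :: real \<times> real \<Rightarrow> real)" by auto
    finally show ?thesis using fst by simp
  qed
  show "integrable (std_gauss \<Otimes>\<^sub>M std_gauss) (\<lambda>z. f (fst z))"
    using f integrable_distr[of fst "std_gauss \<Otimes>\<^sub>M std_gauss" std_gauss f] fst by simp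
  show "integral\<^sup>L (std_gauss \<Otimes>\<^sub>M std_gauss) (\<lambda>z. f (fst z)) = integral\<^sup>L std_gauss f"
    using integral_distr[of fst "std_gauss \<Otimes>\<^sub>M std_gauss" std_gauss f] fst fm by simp
  show "integrable (std_gauss \<Otimes>\<^sub>M std_gauss) (\<lambda>z. f (snd z))"
    using f integrable_distr[of snd "std_gauss \<Otimes>\<^sub>M std_gauss" std_gauss f] snd by simp
  show "integral\<^sup>L (std_gauss \<Otimes>\<^sub>M std_gauss) (\<lambda>z. f (snd z)) = integral\<^sup>L std_gauss f"
    using integral_distr[of snd "std_gauss \<Otimes>\<^sub>M std_gauss" std_gauss f] snd fm by simp
qed

lemma cnormal_map_measurable:
  "(\<lambda>(x, y). Complex (a * x) (a * y)) \<in> std_gauss \<Otimes>\<^sub>M std_gauss \<rightarrow>\<^sub>M borel"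
proof -
  have "(\<lambda>z. of_real (a * fst z) + \<i> * of_real (a * snd z)) \<in> std_gauss \<Otimes>\<^sub>M std_gauss \<rightarrow>\<^sub>M (borel :: complex measure)"
    by measurable
  also have "(\<lambda>z. of_real (a * fst z) + \<i> * of_real (a * snd z)) = (\<lambda>(x, y). Complex (a * x) (a * y))"
    by (auto simp: complex_eq_iff)
  finally show ?thesis .
qed

lemma cnormal_integral:
  fixes f :: "complex \<Rightarrow> 'b::{banach, second_countable_topology}"
  assumes "f \<in> borel_measurable borel"
  shows "integrable (cnormal v) f \<longleftrightarrow> integrable (std_gauss \<Otimes>\<^sub>M std_gauss)
      (\<lambda>z. f (Complex (sqrt (v / 2) * fst z) (sqrt (v / 2) * snd z)))"
    "integral\<^sup>L (cnormal v) f = integral\<^sup>L (std_gauss \<Otimes>\<^sub>M std_gauss)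
      (\<lambda>z. f (Complex (sqrt (v / 2) * fst z) (sqrt (v / 2) * snd z)))"
  unfolding cnormal_def
  using integrable_distr_eq[OF cnormal_map_measurable assms(1), of "sqrt (v / 2)"]
    integral_distr[OF cnormal_map_measurable assms(1), of "sqrt (v / 2)"]
  by (simp_all add: case_prod_beta')

text \<open>For the fourth moment finiteness suffices: its value only enters a constant that is
  later divided by the number of antennas.\<close>

lemma cnormal_moments:
  assumes v: "0 \<le> v"
  shows "integrable (cnormal v) (\<lambda>z. z)" "integral\<^sup>L (cnormal v) (\<lambda>z. z) = 0"
    "integrable (cnormal v) (\<lambda>z. (cmod z)\<^sup>2)" "integral\<^sup>L (cnormal v) (\<lambda>z. (cmod z)\<^sup>2) = v"
    "integrable (cnormal v) (\<lambda>z. (cmod z) ^ 4)"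
proof -
  let ?s = "sqrt (v / 2)" and ?N = "std_gauss \<Otimes>\<^sub>M std_gauss"
  have p: "integrable std_gauss (\<lambda>x. x)" "integrable std_gauss (\<lambda>x. x\<^sup>2)" "integrable std_gauss (\<lambda>x. x ^ 4)"
    using std_gauss_power(1)[of 1] std_gauss_power(1)[of 2] std_gauss_power(1)[of 4] by simp_all
  note P1 = std_gauss_pair[OF p(1)] and P2 = std_gauss_pair[OF p(2)] and P4 = std_gauss_pair[OF p(3)]
  have eq1: "(\<lambda>z. Complex (?s * fst z) (?s * snd z)) =
      (\<lambda>z. of_real ?s * of_real (fst z) + of_real ?s * (\<i> * of_real (snd z)))"
    by (auto simp: complex_eq_iff)
  show "integrable (cnormal v) (\<lambda>z. z)"
    unfolding cnormal_integral(1)[OF measurable_ident_sets[OF refl]] eq1 using P1(1,3)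
    by (intro Bochner_Integration.integrable_add integrable_mult_right integrable_of_real) auto
  show "integral\<^sup>L (cnormal v) (\<lambda>z. z) = 0"
    unfolding cnormal_integral(2)[OF measurable_ident_sets[OF refl]] eq1 using P1
    by (subst Bochner_Integration.integral_add) (auto simp: std_gauss_moments)
  have m2: "(\<lambda>z. (cmod z)\<^sup>2) \<in> borel_measurable borel" by measurable
  have eq2: "(\<lambda>z. (cmod (Complex (?s * fst z) (?s * snd z)))\<^sup>2) = (\<lambda>z. v / 2 * (fst z)\<^sup>2 + v / 2 * (snd z)\<^sup>2)"
    using v by (auto simp: cmod_def power_mult_distrib)
  show "integrable (cnormal v) (\<lambda>z. (cmod z)\<^sup>2)"
    unfolding cnormal_integral(1)[OF m2] eq2 using P2(1,3) by simp
  show "integral\<^sup>L (cnormal v) (\<lambda>z. (cmod z)\<^sup>2) = v"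
    unfolding cnormal_integral(2)[OF m2] eq2 using P2
    by (subst Bochner_Integration.integral_add) (auto simp: std_gauss_moments)
  have m4: "(\<lambda>z. (cmod z) ^ 4) \<in> borel_measurable borel" by measurable
  show "integrable (cnormal v) (\<lambda>z. (cmod z) ^ 4)"
    unfolding cnormal_integral(1)[OF m4]
  proof (rule Bochner_Integration.integrable_bound)
    \<comment> \<open>The dominating function comes from
      \<open>(x + y)^2 \<le> 2 * (x^2 + y^2)\<close> applied to the two halves of the squared
      modulus; the coefficient is \<open>2 * (v / 2)^2\<close>.\<close>
    show "integrable ?N (\<lambda>z. v\<^sup>2 / 2 * (fst z) ^ 4 + v\<^sup>2 / 2 * (snd z) ^ 4)"
      using P4(1,3) by simp
    have "(\<lambda>z. (cmod (of_real ?s * of_real (fst z) + of_real ?s * (\<i> * of_real (snd z)))) ^ 4) \<in> borel_measurable ?N"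
      by measurable
    then show "(\<lambda>z. (cmod (Complex (?s * fst z) (?s * snd z))) ^ 4) \<in> borel_measurable ?N"
      unfolding fun_cong[OF eq1] .
    show "AE z in ?N. norm ((cmod (Complex (?s * fst z) (?s * snd z))) ^ 4) \<le>
        norm (v\<^sup>2 / 2 * (fst z) ^ 4 + v\<^sup>2 / 2 * (snd z) ^ 4)"
    proof (rule AE_I2)
      fix z :: "real \<times> real"
      have "(cmod (Complex (?s * fst z) (?s * snd z))) ^ 4 = ((cmod (Complex (?s * fst z) (?s * snd z)))\<^sup>2)\<^sup>2"
        by simp
      also have "\<dots> = (v / 2 * (fst z)\<^sup>2 + v / 2 * (snd z)\<^sup>2)\<^sup>2" using fun_cong[OF eq2, of z] by simp
      also have "\<dots> \<le> 2 * ((v / 2 * (fst z)\<^sup>2)\<^sup>2 + (v / 2 * (snd z)\<^sup>2)\<^sup>2)"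
        using sum_squares_bound[of "v / 2 * (fst z)\<^sup>2" "v / 2 * (snd z)\<^sup>2"] by (simp add: power2_sum)
      also have "\<dots> = v\<^sup>2 / 2 * (fst z) ^ 4 + v\<^sup>2 / 2 * (snd z) ^ 4"
        by (simp add: power_mult_distrib power_divide)
      finally show "norm ((cmod (Complex (?s * fst z) (?s * snd z))) ^ 4) \<le>
        norm (v\<^sup>2 / 2 * (fst z) ^ 4 + v\<^sup>2 / 2 * (snd z) ^ 4)" by simp
    qed
  qed
qed

lemma cnj_measurable [measurable]: "cnj \<in> borel_measurable borel"
  by (intro borel_measurable_continuous_onI continuous_intros)

lemma (in prob_space) expectation_le_sqrt:
  fixes X :: "'a \<Rightarrow> real"
  assumes "integrable M X" "integrable M (\<lambda>\<omega>. (X \<omega>)\<^sup>2)" "expectation (\<lambda>\<omega>. (X \<omega>)\<^sup>2) \<le> C"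
  shows "expectation X \<le> sqrt C"
proof -
  have "0 \<le> expectation (\<lambda>\<omega>. (X \<omega>)\<^sup>2) - (expectation X)\<^sup>2"
    using variance_positive[of X] variance_eq[OF assms(1,2)] by simp
  then show ?thesis using assms(3) by (intro real_le_rsqrt) simp
qed

lemma (in prob_space) square_integrable_imp:
  fixes X :: "'a \<Rightarrow> complex"
  assumes [measurable]: "X \<in> borel_measurable M" and i: "integrable M (\<lambda>\<omega>. (cmod (X \<omega>))\<^sup>2)"
  shows "integrable M X"
proof (rule Bochner_Integration.integrable_bound)
  show "integrable M (\<lambda>\<omega>. 1 + (cmod (X \<omega>))\<^sup>2)" using i by simp
  have "cmod z \<le> 1 + (cmod z)\<^sup>2" for z
  proof -
    have "2 * cmod z \<le> 1 + (cmod z)\<^sup>2" using sum_squares_bound[of 1 "cmod z"] by simp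
    then show ?thesis using norm_ge_zero[of z] by linarith
  qed
  then show "AE \<omega> in M. norm (X \<omega>) \<le> norm (1 + (cmod (X \<omega>))\<^sup>2)" by simp
qed simp

lemma norm_mult_le_squares: "norm (x * y) \<le> ((norm x)\<^sup>2 + (norm y)\<^sup>2) / 2"
  for x y :: "'a::real_normed_div_algebra"
  using sum_squares_bound[of "norm x" "norm y"] by (simp add: norm_mult)

text \<open>The arithmetic-geometric mean inequality replaces Cauchy-Schwarz; for factors with a
  common second moment bound \<open>C\<close> it still yields \<open>C\<close>.\<close>

lemma (in prob_space) square_integrable_mult:
  fixes X Y :: "'a \<Rightarrow> complex"
  assumes [measurable]: "X \<in> borel_measurable M" "Y \<in> borel_measurable M"
    and i: "integrable M (\<lambda>\<omega>. (cmod (X \<omega>))\<^sup>2)" "integrable M (\<lambda>\<omega>. (cmod (Y \<omega>))\<^sup>2)"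
  shows "integrable M (\<lambda>\<omega>. X \<omega> * Y \<omega>)"
    "expectation (\<lambda>\<omega>. cmod (X \<omega> * Y \<omega>)) \<le>
      (expectation (\<lambda>\<omega>. (cmod (X \<omega>))\<^sup>2) + expectation (\<lambda>\<omega>. (cmod (Y \<omega>))\<^sup>2)) / 2"
proof -
  have int: "integrable M (\<lambda>\<omega>. ((cmod (X \<omega>))\<^sup>2 + (cmod (Y \<omega>))\<^sup>2) / 2)" using i by simp
  show XY: "integrable M (\<lambda>\<omega>. X \<omega> * Y \<omega>)"
    by (rule Bochner_Integration.integrable_bound[OF int]) (simp, rule AE_I2, rule order.trans[OF norm_mult_le_squares], simp)
  have "expectation (\<lambda>\<omega>. cmod (X \<omega> * Y \<omega>)) \<le> expectation (\<lambda>\<omega>. ((cmod (X \<omega>))\<^sup>2 + (cmod (Y \<omega>))\<^sup>2) / 2)"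
    by (rule integral_mono[OF integrable_norm[OF XY] int norm_mult_le_squares])
  then show "expectation (\<lambda>\<omega>. cmod (X \<omega> * Y \<omega>)) \<le>
      (expectation (\<lambda>\<omega>. (cmod (X \<omega>))\<^sup>2) + expectation (\<lambda>\<omega>. (cmod (Y \<omega>))\<^sup>2)) / 2"
    using i by simp
qed

lemma (in prob_space) indep_vars_pair:
  assumes ind: "indep_vars (\<lambda>_. borel) Z I" and ij: "i \<in> I" "j \<in> I" "i \<noteq> j"
    and f [measurable]: "f \<in> borel \<rightarrow>\<^sub>M borel" and g [measurable]: "g \<in> borel \<rightarrow>\<^sub>M borel"
  shows "indep_var borel (\<lambda>\<omega>. f (Z i \<omega>)) borel (\<lambda>\<omega>. g (Z j \<omega>))"
proof -
  have "indep_var borel ((\<lambda>x. f (x i)) \<circ> (\<lambda>\<omega>. \<lambda>l\<in>{i}. Z l \<omega>)) borel ((\<lambda>x. g (x j)) \<circ> (\<lambda>\<omega>. \<lambda>l\<in>{j}. Z l \<omega>))"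
    using ij by (intro indep_var_compose[OF indep_var_restrict[OF ind, of "{i}" "{j}"]]) auto
  then show ?thesis by (simp add: comp_def)
qed

text \<open>A weak law with explicit rate: cross terms vanish by independence and zero mean, so the
  second moment of the average is at most \<open>C / m\<close>, and nonnegativity of the variance
  passes to the first moment. The explicit rate makes it usable when the probability space changes
  with \<open>m\<close>.\<close>

lemma (in prob_space) mean_of_indep_bound:
  fixes Z :: "nat \<Rightarrow> 'a \<Rightarrow> complex"
  assumes ind: "indep_vars (\<lambda>_. borel) Z {..<m}"
    and sq: "\<And>i. i < m \<Longrightarrow> integrable M (\<lambda>\<omega>. (cmod (Z i \<omega>))\<^sup>2)"
    and mean: "\<And>i. i < m \<Longrightarrow> expectation (Z i) = 0"
    and C: "\<And>i. i < m \<Longrightarrow> expectation (\<lambda>\<omega>. (cmod (Z i \<omega>))\<^sup>2) \<le> C"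
    and m: "0 < m"
  shows "expectation (\<lambda>\<omega>. cmod ((\<Sum>i<m. Z i \<omega>) / of_nat m)) \<le> sqrt (C / m)"
proof -
  have meas: "Z i \<in> borel_measurable M" if "i < m" for i
    using ind that by (auto simp: indep_vars_def)
  have Zint: "integrable M (Z i)" if "i < m" for i
    using square_integrable_imp[OF meas sq] that by blast
  let ?W = "\<lambda>\<omega>. (\<Sum>i<m. Z i \<omega>) / of_nat m"
  have Wint: "integrable M ?W" using Zint by (auto intro!: Bochner_Integration.integrable_sum)
  have prod: "integrable M (\<lambda>\<omega>. Z i \<omega> * cnj (Z j \<omega>))" if "i < m" "j < m" for i j
    using sq that by (intro square_integrable_mult measurable_compose[OF meas cnj_measurable] meas) auto
  have cross: "expectation (\<lambda>\<omega>. Z i \<omega> * cnj (Z j \<omega>)) = 0" if ij: "i < m" "j < m" "i \<noteq> j" for i j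
  proof -
    have "indep_var borel (\<lambda>\<omega>. Z i \<omega>) borel (\<lambda>\<omega>. cnj (Z j \<omega>))"
      using ij by (intro indep_vars_pair[OF ind, where f = "\<lambda>x. x"]) auto
    then have "expectation (\<lambda>\<omega>. Z i \<omega> * cnj (Z j \<omega>)) = expectation (Z i) * expectation (\<lambda>\<omega>. cnj (Z j \<omega>))"
      using Zint ij by (intro indep_var_lebesgue_integral) auto
    then show ?thesis using mean ij by simp
  qed
  \<comment> \<open>The squared modulus is expanded as a complex double sum, since only there do the
    cross terms factor under the expectation. The return to reals uses injectivity of
    \<open>of_real\<close>.\<close>
  have W2: "complex_of_real ((cmod (?W \<omega>))\<^sup>2) = (\<Sum>i<m. \<Sum>j<m. Z i \<omega> * cnj (Z j \<omega>)) / of_nat (m * m)" for \<omega>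
    unfolding complex_norm_square by (simp add: sum_product)
  have Wc: "integrable M (\<lambda>\<omega>. complex_of_real ((cmod (?W \<omega>))\<^sup>2))"
    unfolding W2 using prod by (auto intro!: Bochner_Integration.integrable_sum)
  then have W2int: "integrable M (\<lambda>\<omega>. (cmod (?W \<omega>))\<^sup>2)" by (simp only: complex_of_real_integrable_eq)
  have "expectation (\<lambda>\<omega>. \<Sum>i<m. \<Sum>j<m. Z i \<omega> * cnj (Z j \<omega>)) =
      (\<Sum>i<m. expectation (\<lambda>\<omega>. \<Sum>j<m. Z i \<omega> * cnj (Z j \<omega>)))"
    using prod by (intro Bochner_Integration.integral_sum Bochner_Integration.integrable_sum) auto
  also have "\<dots> = (\<Sum>i<m. \<Sum>j<m. expectation (\<lambda>\<omega>. Z i \<omega> * cnj (Z j \<omega>)))"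
    using prod by (intro sum.cong refl Bochner_Integration.integral_sum) auto
  finally have int_sum: "expectation (\<lambda>\<omega>. \<Sum>i<m. \<Sum>j<m. Z i \<omega> * cnj (Z j \<omega>)) =
      (\<Sum>i<m. \<Sum>j<m. expectation (\<lambda>\<omega>. Z i \<omega> * cnj (Z j \<omega>)))" .
  have "complex_of_real (expectation (\<lambda>\<omega>. (cmod (?W \<omega>))\<^sup>2)) =
      (\<Sum>i<m. \<Sum>j<m. expectation (\<lambda>\<omega>. Z i \<omega> * cnj (Z j \<omega>))) / of_nat (m * m)"
    unfolding integral_complex_of_real[symmetric] W2 by (simp add: int_sum)
  also have "\<dots> = (\<Sum>i<m. \<Sum>j<m. if i = j then expectation (\<lambda>\<omega>. Z i \<omega> * cnj (Z i \<omega>)) else 0) / of_nat (m * m)"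
    using cross by (intro arg_cong2[where f = "(/)"] sum.cong refl) auto
  also have "\<dots> = (\<Sum>i<m. expectation (\<lambda>\<omega>. Z i \<omega> * cnj (Z i \<omega>))) / of_nat (m * m)"
    by simp
  also have "\<dots> = complex_of_real ((\<Sum>i<m. expectation (\<lambda>\<omega>. (cmod (Z i \<omega>))\<^sup>2)) / (m * m))"
    unfolding complex_norm_square[symmetric] integral_complex_of_real by simp
  finally have "expectation (\<lambda>\<omega>. (cmod (?W \<omega>))\<^sup>2) = (\<Sum>i<m. expectation (\<lambda>\<omega>. (cmod (Z i \<omega>))\<^sup>2)) / (m * m)"
    unfolding of_real_eq_iff .
  also have "\<dots> \<le> (\<Sum>i<m. C) / (m * m)" using C by (intro divide_right_mono sum_mono) auto
  also have "\<dots> = C / m" using m by simp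
  finally have "expectation (\<lambda>\<omega>. (cmod (?W \<omega>))\<^sup>2) \<le> C / m" .
  with Wint W2int show ?thesis by (intro expectation_le_sqrt) auto
qed

section \<open>Convergence in mean along a sequence of probability spaces\<close>

text \<open>Each \<open>M\<close> has its own probability space. Integrability is demanded
  explicitly because the integral of a non-integrable function is \<open>0\<close> by convention,
  which would make the limit condition hold vacuously; it is demanded only eventually since the
  model makes sense only from \<open>M = K\<close> on.\<close>

definition L1_lim :: "(nat \<Rightarrow> 'w measure) \<Rightarrow> (nat \<Rightarrow> 'w \<Rightarrow> complex) \<Rightarrow> complex \<Rightarrow> bool" where
  "L1_lim P X c \<longleftrightarrow> (\<forall>\<^sub>F M in sequentially. integrable (P M) (X M)) \<and>
     (\<lambda>M. \<integral>\<omega>. cmod (X M \<omega> - c) \<partial>P M) \<longlonglongrightarrow> 0"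

context
  fixes P :: "nat \<Rightarrow> 'w measure"
  assumes prob: "\<forall>\<^sub>F M in sequentially. prob_space (P M)"
begin

lemma L1_limI:
  assumes int: "\<forall>\<^sub>F M in sequentially. integrable (P M) (X M)"
    and le: "\<forall>\<^sub>F M in sequentially. (\<integral>\<omega>. cmod (X M \<omega> - c) \<partial>P M) \<le> f M"
    and f: "f \<longlonglongrightarrow> 0"
  shows "L1_lim P X c"
  unfolding L1_lim_def
proof (intro conjI int)
  show "(\<lambda>M. \<integral>\<omega>. cmod (X M \<omega> - c) \<partial>P M) \<longlonglongrightarrow> 0"
    by (rule Lim_null_comparison[OF _ f]) (use le in \<open>auto elim: eventually_mono\<close>)
qed

lemma L1_lim_const: "L1_lim P (\<lambda>M \<omega>. c) c"
  using prob by (intro L1_limI[where f = "\<lambda>_. 0"])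
    (auto elim!: eventually_mono intro: finite_measure.integrable_const prob_space.axioms(1))

lemma L1_lim_add:
  assumes X: "L1_lim P X c" and Y: "L1_lim P Y d"
  shows "L1_lim P (\<lambda>M \<omega>. X M \<omega> + Y M \<omega>) (c + d)"
proof (rule L1_limI)
  have *: "\<forall>\<^sub>F M in sequentially. prob_space (P M) \<and> integrable (P M) (X M) \<and> integrable (P M) (Y M)"
    using X Y prob by (auto simp: L1_lim_def eventually_conj_iff)
  show "\<forall>\<^sub>F M in sequentially. integrable (P M) (\<lambda>\<omega>. X M \<omega> + Y M \<omega>)"
    using * by (auto elim!: eventually_mono)
  show "\<forall>\<^sub>F M in sequentially. (\<integral>\<omega>. cmod (X M \<omega> + Y M \<omega> - (c + d)) \<partial>P M) \<le>
      (\<integral>\<omega>. cmod (X M \<omega> - c) \<partial>P M) + (\<integral>\<omega>. cmod (Y M \<omega> - d) \<partial>P M)"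
    using *
  proof (rule eventually_mono)
    fix M assume M: "prob_space (P M) \<and> integrable (P M) (X M) \<and> integrable (P M) (Y M)"
    then interpret prob_space "P M" by simp
    have "(\<integral>\<omega>. cmod (X M \<omega> + Y M \<omega> - (c + d)) \<partial>P M) \<le> (\<integral>\<omega>. cmod (X M \<omega> - c) + cmod (Y M \<omega> - d) \<partial>P M)"
      using M by (intro integral_mono) (auto intro: norm_diff_triangle_ineq)
    then show "(\<integral>\<omega>. cmod (X M \<omega> + Y M \<omega> - (c + d)) \<partial>P M) \<le>
      (\<integral>\<omega>. cmod (X M \<omega> - c) \<partial>P M) + (\<integral>\<omega>. cmod (Y M \<omega> - d) \<partial>P M)"
      using M by simp
  qed
  show "(\<lambda>M. (\<integral>\<omega>. cmod (X M \<omega> - c) \<partial>P M) + (\<integral>\<omega>. cmod (Y M \<omega> - d) \<partial>P M)) \<longlonglongrightarrow> 0"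
    using X Y unfolding L1_lim_def by (auto intro: tendsto_add_zero)
qed

lemma L1_lim_sum:
  assumes "\<And>i. i \<in> I \<Longrightarrow> L1_lim P (X i) (c i)"
  shows "L1_lim P (\<lambda>M \<omega>. \<Sum>i\<in>I. X i M \<omega>) (\<Sum>i\<in>I. c i)"
  using assms
proof (induction I rule: infinite_finite_induct)
  case (insert i I)
  then show ?case by (simp add: L1_lim_add)
qed (simp_all add: L1_lim_const)

lemma L1_lim_scale:
  assumes X: "L1_lim P X c" and a: "a \<longlonglongrightarrow> l"
  shows "L1_lim P (\<lambda>M \<omega>. a M * X M \<omega>) (l * c)"
proof (rule L1_limI)
  have *: "\<forall>\<^sub>F M in sequentially. prob_space (P M) \<and> integrable (P M) (X M)"
    using X prob by (auto simp: L1_lim_def eventually_conj_iff)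
  show "\<forall>\<^sub>F M in sequentially. integrable (P M) (\<lambda>\<omega>. a M * X M \<omega>)"
    using * by (auto elim!: eventually_mono)
  show "\<forall>\<^sub>F M in sequentially. (\<integral>\<omega>. cmod (a M * X M \<omega> - l * c) \<partial>P M) \<le>
      cmod (a M) * (\<integral>\<omega>. cmod (X M \<omega> - c) \<partial>P M) + cmod (a M - l) * cmod c"
    using *
  proof (rule eventually_mono)
    fix M assume M: "prob_space (P M) \<and> integrable (P M) (X M)"
    then interpret prob_space "P M" by simp
    have "cmod (a M * X M \<omega> - l * c) \<le> cmod (a M) * cmod (X M \<omega> - c) + cmod (a M - l) * cmod c" for \<omega>
    proof -
      have eq: "a M * X M \<omega> - l * c = a M * (X M \<omega> - c) + (a M - l) * c" by (simp add: algebra_simps)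
      show ?thesis unfolding eq by (rule order.trans[OF norm_triangle_ineq]) (simp add: norm_mult)
    qed
    then have "(\<integral>\<omega>. cmod (a M * X M \<omega> - l * c) \<partial>P M) \<le>
        (\<integral>\<omega>. cmod (a M) * cmod (X M \<omega> - c) + cmod (a M - l) * cmod c \<partial>P M)"
      using M by (intro integral_mono) auto
    then show "(\<integral>\<omega>. cmod (a M * X M \<omega> - l * c) \<partial>P M) \<le>
      cmod (a M) * (\<integral>\<omega>. cmod (X M \<omega> - c) \<partial>P M) + cmod (a M - l) * cmod c"
      using M by (simp add: prob_space)
  qed
  have "(\<lambda>M. cmod (a M) * (\<integral>\<omega>. cmod (X M \<omega> - c) \<partial>P M) + cmod (a M - l) * cmod c)
      \<longlonglongrightarrow> cmod l * 0 + cmod (l - l) * cmod c"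
    using X a unfolding L1_lim_def by (intro tendsto_intros) auto
  then show "(\<lambda>M. cmod (a M) * (\<integral>\<omega>. cmod (X M \<omega> - c) \<partial>P M) + cmod (a M - l) * cmod c) \<longlonglongrightarrow> 0"
    by simp
qed

text \<open>For terms that are merely bounded in mean: a vanishing deterministic factor suffices.
  All terms involving the channel are removed this way.\<close>

lemma L1_lim_vanishing:
  assumes X: "\<forall>\<^sub>F M in sequentially. integrable (P M) (X M)"
      "\<forall>\<^sub>F M in sequentially. (\<integral>\<omega>. cmod (X M \<omega>) \<partial>P M) \<le> C"
    and a: "a \<longlonglongrightarrow> 0"
  shows "L1_lim P (\<lambda>M \<omega>. a M * X M \<omega>) 0"
proof (rule L1_limI)
  show "\<forall>\<^sub>F M in sequentially. integrable (P M) (\<lambda>\<omega>. a M * X M \<omega>)"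
    using X(1) by (auto elim!: eventually_mono)
  show "\<forall>\<^sub>F M in sequentially. (\<integral>\<omega>. cmod (a M * X M \<omega> - 0) \<partial>P M) \<le> cmod (a M) * C"
    using X(2) by (auto elim!: eventually_mono intro: mult_left_mono simp: norm_mult)
  show "(\<lambda>M. cmod (a M) * C) \<longlonglongrightarrow> 0"
    using a by (intro tendsto_mult_left_zero tendsto_norm_zero)
qed

end

lemma L1_lim_cong:
  assumes "\<forall>\<^sub>F M in sequentially. \<forall>\<omega>. X M \<omega> = Y M \<omega>"
  shows "L1_lim P X c \<longleftrightarrow> L1_lim P Y c"
proof -
  have *: "\<forall>\<^sub>F M in sequentially. X M = Y M"
    using assms by (auto elim!: eventually_mono)
  have 1: "(\<forall>\<^sub>F M in sequentially. integrable (P M) (X M)) \<longleftrightarrow> (\<forall>\<^sub>F M in sequentially. integrable (P M) (Y M))"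
    using * by (rule eventually_cong[OF _ ]) simp
  have 2: "((\<lambda>M. \<integral>\<omega>. cmod (X M \<omega> - c) \<partial>P M) \<longlonglongrightarrow> 0) \<longleftrightarrow> ((\<lambda>M. \<integral>\<omega>. cmod (Y M \<omega> - c) \<partial>P M) \<longlonglongrightarrow> 0)"
    using * by (intro tendsto_cong) (auto elim!: eventually_mono)
  show ?thesis unfolding L1_lim_def 1 2 ..
qed

section \<open>Correlations averaged over the antennas\<close>

definition emp_corr :: "nat \<Rightarrow> (nat \<Rightarrow> 'w \<Rightarrow> complex) \<Rightarrow> (nat \<Rightarrow> 'w \<Rightarrow> complex) \<Rightarrow> 'w \<Rightarrow> complex" where
  "emp_corr M X Y \<omega> = (\<Sum>m<M. cnj (X m \<omega>) * Y m \<omega>) / of_nat M"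

lemma emp_corr_add_scaled:
  "emp_corr M (\<lambda>m \<omega>. X m \<omega> + of_real s * U m \<omega>) (\<lambda>m \<omega>. Y m \<omega> + of_real s * V m \<omega>) \<omega> =
    emp_corr M X Y \<omega> + of_real s * emp_corr M X V \<omega> + of_real s * emp_corr M U Y \<omega>
      + of_real (s * s) * emp_corr M U V \<omega>"
  by (simp add: emp_corr_def algebra_simps sum.distrib sum_distrib_left add_divide_distrib)

text \<open>Each summand is bounded in mean by \<open>C\<close>, and averaging preserves the bound,
  so it is uniform in the number of antennas.\<close>

lemma (in prob_space) emp_corr_bound:
  fixes X Y :: "nat \<Rightarrow> 'a \<Rightarrow> complex"
  assumes meas: "\<And>m. m < n \<Longrightarrow> X m \<in> borel_measurable M" "\<And>m. m < n \<Longrightarrow> Y m \<in> borel_measurable M"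
    and int: "\<And>m. m < n \<Longrightarrow> integrable M (\<lambda>\<omega>. (cmod (X m \<omega>))\<^sup>2)"
      "\<And>m. m < n \<Longrightarrow> integrable M (\<lambda>\<omega>. (cmod (Y m \<omega>))\<^sup>2)"
    and le: "\<And>m. m < n \<Longrightarrow> expectation (\<lambda>\<omega>. (cmod (X m \<omega>))\<^sup>2) \<le> C"
      "\<And>m. m < n \<Longrightarrow> expectation (\<lambda>\<omega>. (cmod (Y m \<omega>))\<^sup>2) \<le> C"
    and n: "0 < n"
  shows "integrable M (emp_corr n X Y)" "expectation (\<lambda>\<omega>. cmod (emp_corr n X Y \<omega>)) \<le> C"
proof -
  have XY: "integrable M (\<lambda>\<omega>. cnj (X m \<omega>) * Y m \<omega>)"
    "expectation (\<lambda>\<omega>. cmod (cnj (X m \<omega>) * Y m \<omega>)) \<le> C" if "m < n" for m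
  proof -
    note * = square_integrable_mult[OF measurable_compose[OF meas(1) cnj_measurable] meas(2), of m m]
    show "integrable M (\<lambda>\<omega>. cnj (X m \<omega>) * Y m \<omega>)" using *(1) int that by simp
    show "expectation (\<lambda>\<omega>. cmod (cnj (X m \<omega>) * Y m \<omega>)) \<le> C"
      using *(2) int[OF that] le[OF that] that by simp
  qed
  show "integrable M (emp_corr n X Y)"
    unfolding emp_corr_def using XY(1) by (auto intro!: Bochner_Integration.integrable_sum)
  have nint: "integrable M (\<lambda>\<omega>. cmod (cnj (X m \<omega>) * Y m \<omega>))" if "m \<in> {..<n}" for m
    using XY(1)[of m] that by (intro integrable_norm) simp
  have "expectation (\<lambda>\<omega>. cmod (emp_corr n X Y \<omega>)) \<le>
      expectation (\<lambda>\<omega>. (\<Sum>m<n. cmod (cnj (X m \<omega>) * Y m \<omega>)) / n)"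
  proof (rule integral_mono)
    show "integrable M (\<lambda>\<omega>. cmod (emp_corr n X Y \<omega>))"
      by (rule integrable_norm) fact
    show "integrable M (\<lambda>\<omega>. (\<Sum>m<n. cmod (cnj (X m \<omega>) * Y m \<omega>)) / n)"
      by (intro integrable_divide_zero Bochner_Integration.integrable_sum nint)
    show "cmod (emp_corr n X Y \<omega>) \<le> (\<Sum>m<n. cmod (cnj (X m \<omega>) * Y m \<omega>)) / n" for \<omega>
      unfolding emp_corr_def norm_divide norm_of_nat by (intro divide_right_mono norm_sum) simp
  qed
  also have "\<dots> = (\<Sum>m<n. expectation (\<lambda>\<omega>. cmod (cnj (X m \<omega>) * Y m \<omega>))) / n"
    by (subst integral_divide_zero, subst Bochner_Integration.integral_sum[OF nint]) (assumption, rule refl)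
  also have "\<dots> \<le> (\<Sum>m<n. C) / n" using XY(2) by (intro divide_right_mono sum_mono) auto
  also have "\<dots> = C" using n by simp
  finally show "expectation (\<lambda>\<omega>. cmod (emp_corr n X Y \<omega>)) \<le> C" .
qed

lemma iid_cnormal_moments:
  assumes "prob_space P" "iid_cnormal P v X I" "0 \<le> v" "i \<in> I"
  shows "X i \<in> borel_measurable P"
    "integrable P (X i)" "integral\<^sup>L P (X i) = 0"
    "integrable P (\<lambda>\<omega>. (cmod (X i \<omega>))\<^sup>2)" "integral\<^sup>L P (\<lambda>\<omega>. (cmod (X i \<omega>))\<^sup>2) = v"
    "integrable P (\<lambda>\<omega>. (cmod (X i \<omega>)) ^ 4)"
    "integral\<^sup>L P (\<lambda>\<omega>. (cmod (X i \<omega>)) ^ 4) = integral\<^sup>L (cnormal v) (\<lambda>z. cmod z ^ 4)"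
proof -
  interpret prob_space P by fact
  show m: "X i \<in> borel_measurable P"
    using assms unfolding iid_cnormal_def indep_vars_def by auto
  have d: "distr P borel (X i) = cnormal v" using assms by (simp add: iid_cnormal_def)
  note c = cnormal_moments[OF assms(3), folded d]
  show "integrable P (X i)" using integrable_distr[OF m c(1)] .
  show "integral\<^sup>L P (X i) = 0" using c(2) integral_distr[OF m, of "\<lambda>z. z"] by simp
  show "integrable P (\<lambda>\<omega>. (cmod (X i \<omega>))\<^sup>2)" using integrable_distr[OF m c(3)] .
  show "integral\<^sup>L P (\<lambda>\<omega>. (cmod (X i \<omega>))\<^sup>2) = v" using c(4) integral_distr[OF m, of "\<lambda>z. (cmod z)\<^sup>2"] by simp
  show "integrable P (\<lambda>\<omega>. (cmod (X i \<omega>)) ^ 4)" using integrable_distr[OF m c(5)] .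
  show "integral\<^sup>L P (\<lambda>\<omega>. (cmod (X i \<omega>)) ^ 4) = integral\<^sup>L (cnormal v) (\<lambda>z. cmod z ^ 4)"
    unfolding d[symmetric] using integral_distr[OF m, of "\<lambda>z. (cmod z) ^ 4"] by simp
qed

text \<open>The summands for different antennas, centred at their mean, are independent with second
  moment controlled by the fourth moment of the noise, so the weak law applies at rate
  \<open>1 / sqrt M\<close>. The mean is \<open>1\<close> exactly when both noise processes are the
  same.\<close>

lemma noise_emp_corr:
  fixes b :: "nat \<Rightarrow> int \<Rightarrow> nat \<Rightarrow> 'w \<Rightarrow> complex"
  assumes "prob_space P" and noise: "iid_cnormal P 1 (\<lambda>(k, n, m). b k n m) ({..<K} \<times> UNIV \<times> {..<M})"
    and i: "i < K" "i' < K" and M: "0 < M"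
  shows "integrable P (emp_corr M (b i t) (b i' t'))"
    "(\<integral>\<omega>. cmod (emp_corr M (b i t) (b i' t') \<omega> - (if (i, t) = (i', t') then 1 else 0)) \<partial>P) \<le>
      sqrt ((2 * integral\<^sup>L (cnormal 1) (\<lambda>z. cmod z ^ 4) + 2) / M)"
proof -
  interpret prob_space P by fact
  let ?I = "{..<K} \<times> (UNIV :: int set) \<times> {..<M}"
  define d :: complex where "d = (if (i, t) = (i', t') then 1 else 0)"
  define m4 where "m4 = integral\<^sup>L (cnormal 1) (\<lambda>z. cmod z ^ 4)"
  define Z where "Z m \<omega> = cnj (b i t m \<omega>) * b i' t' m \<omega> - d" for m \<omega>
  have ind: "indep_vars (\<lambda>_. borel) (\<lambda>(k, n, m). b k n m) ?I" using noise by (simp add: iid_cnormal_def)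
  have mom: "b l u m \<in> borel_measurable P" "integrable P (b l u m)" "expectation (b l u m) = 0"
    "integrable P (\<lambda>\<omega>. (cmod (b l u m \<omega>))\<^sup>2)" "expectation (\<lambda>\<omega>. (cmod (b l u m \<omega>))\<^sup>2) = 1"
    "integrable P (\<lambda>\<omega>. (cmod (b l u m \<omega>)) ^ 4)" "expectation (\<lambda>\<omega>. (cmod (b l u m \<omega>)) ^ 4) = m4"
    if "l < K" "m < M" for l u m
    using iid_cnormal_moments[OF assms(1) noise, of "(l, u, m)"] that by (simp_all add: m4_def)
  have prod: "integrable P (\<lambda>\<omega>. cnj (b i t m \<omega>) * b i' t' m \<omega>)" if "m < M" for m
  proof (rule square_integrable_mult)
    show "(\<lambda>\<omega>. cnj (b i t m \<omega>)) \<in> borel_measurable P"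
      by (rule measurable_compose[OF mom(1)[OF i(1) that] cnj_measurable])
    show "integrable P (\<lambda>\<omega>. (cmod (cnj (b i t m \<omega>)))\<^sup>2)" using mom(4)[OF i(1) that] by simp
  qed (rule mom[OF i(2) that])+
  show "integrable P (emp_corr M (b i t) (b i' t'))"
    unfolding emp_corr_def using prod by (auto intro!: Bochner_Integration.integrable_sum)
  have indZ: "indep_vars (\<lambda>_. borel) Z {..<M}"
  proof -
    \<comment> \<open>Noise entries are grouped by antenna. The groups are disjoint for different
      \<open>m\<close>, even when the two labels coincide and a group collapses to a single
      entry.\<close>
    let ?L = "\<lambda>m. {(i, t, m), (i', t', m)}"
    have "indep_vars (\<lambda>m. PiM (?L m) (\<lambda>_. borel)) (\<lambda>m \<omega>. \<lambda>x\<in>?L m. (case x of (k, n, m) \<Rightarrow> b k n m) \<omega>) {..<M}"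
      using i by (intro indep_vars_restrict[OF ind]) (auto simp: disjoint_family_on_def)
    then have "indep_vars (\<lambda>_. borel) (\<lambda>m. (\<lambda>f. cnj (f (i, t, m)) * f (i', t', m) - d) \<circ>
        (\<lambda>\<omega>. \<lambda>x\<in>?L m. (case x of (k, n, m) \<Rightarrow> b k n m) \<omega>)) {..<M}"
    proof (rule indep_vars_compose)
      fix m
      have "(\<lambda>f. f x) \<in> borel_measurable (PiM (?L m) (\<lambda>_. borel))" if "x \<in> ?L m" for x
        by (rule measurable_component_singleton[OF that])
      then show "(\<lambda>f. cnj (f (i, t, m)) * f (i', t', m) - d) \<in> borel_measurable (PiM (?L m) (\<lambda>_. borel))"
        by (intro borel_measurable_diff borel_measurable_times borel_measurable_const
            measurable_compose[OF _ cnj_measurable]) simp_all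
    qed
    also have "(\<lambda>m. (\<lambda>f. cnj (f (i, t, m)) * f (i', t', m) - d) \<circ>
        (\<lambda>\<omega>. \<lambda>x\<in>?L m. (case x of (k, n, m) \<Rightarrow> b k n m) \<omega>)) = Z"
      by (auto simp: fun_eq_iff Z_def)
    finally show ?thesis .
  qed
  have mean: "expectation (Z m) = 0" if m: "m < M" for m
  proof -
    have "expectation (\<lambda>\<omega>. cnj (b i t m \<omega>) * b i' t' m \<omega>) = d"
    proof (cases "(i, t) = (i', t')")
      case True
      have "expectation (\<lambda>\<omega>. cnj (b i t m \<omega>) * b i' t' m \<omega>) = expectation (\<lambda>\<omega>. complex_of_real ((cmod (b i t m \<omega>))\<^sup>2))"
        using True unfolding complex_norm_square by (simp add: mult.commute)
      also have "\<dots> = 1" unfolding integral_complex_of_real using mom(5)[OF i(1) m] by simp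
      finally show ?thesis using True by (simp add: d_def)
    next
      case False
      then have "indep_var borel (\<lambda>\<omega>. cnj (b i t m \<omega>)) borel (\<lambda>\<omega>. b i' t' m \<omega>)"
        using indep_vars_pair[OF ind _ _ _ cnj_measurable measurable_ident_sets[OF refl], of "(i, t, m)" "(i', t', m)"] i m
        by (simp add: id_def)
      then have "expectation (\<lambda>\<omega>. cnj (b i t m \<omega>) * b i' t' m \<omega>) =
          expectation (\<lambda>\<omega>. cnj (b i t m \<omega>)) * expectation (\<lambda>\<omega>. b i' t' m \<omega>)"
        using mom(2)[OF i(1) m] mom(2)[OF i(2) m] by (intro indep_var_lebesgue_integral) auto
      then show ?thesis using mom(3)[OF i(2) m] False by (auto simp: d_def)
    qed
    then show ?thesis using prod[OF m] unfolding Z_def[abs_def] by (simp add: prob_space)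
  qed
  \<comment> \<open>With \<open>x\<close> and \<open>y\<close> the two moduli and \<open>d\<close>
    of modulus at most \<open>1\<close>:
    \<open>(x y + 1)^2 \<le> 2 x^2 y^2 + 2 \<le> x^4 + y^4 + 2\<close>.\<close>
  have Zbound: "(cmod (Z m \<omega>))\<^sup>2 \<le> (cmod (b i t m \<omega>)) ^ 4 + (cmod (b i' t' m \<omega>)) ^ 4 + 2" for m \<omega>
  proof -
    let ?x = "cmod (b i t m \<omega>)" and ?y = "cmod (b i' t' m \<omega>)"
    have "cmod (Z m \<omega>) \<le> ?x * ?y + 1"
      unfolding Z_def using norm_triangle_ineq4[of "cnj (b i t m \<omega>) * b i' t' m \<omega>" d]
      by (auto simp: norm_mult d_def)
    then have "(cmod (Z m \<omega>))\<^sup>2 \<le> (?x * ?y + 1)\<^sup>2" by (intro power_mono) auto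
    also have "\<dots> \<le> 2 * (?x * ?y)\<^sup>2 + 2"
      using sum_squares_bound[of "?x * ?y" 1] by (simp add: power2_sum)
    also have "2 * (?x * ?y)\<^sup>2 \<le> ?x ^ 4 + ?y ^ 4"
      using sum_squares_bound[of "?x\<^sup>2" "?y\<^sup>2"] by (simp add: power_mult_distrib)
    finally show ?thesis by simp
  qed
  have Zmeas: "Z m \<in> borel_measurable P" if "m < M" for m
    using indZ that by (auto simp: indep_vars_def)
  have bint: "integrable P (\<lambda>\<omega>. (cmod (b i t m \<omega>)) ^ 4 + (cmod (b i' t' m \<omega>)) ^ 4 + 2)" if "m < M" for m
    using mom(6)[OF i(1) that] mom(6)[OF i(2) that] by simp
  have Zsq: "integrable P (\<lambda>\<omega>. (cmod (Z m \<omega>))\<^sup>2)" if m: "m < M" for m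
    by (rule Bochner_Integration.integrable_bound[OF bint[OF m]])
       (use Zmeas[OF m] in measurable, intro AE_I2, use Zbound in \<open>simp add: order.trans[OF Zbound abs_ge_self]\<close>)
  have Zsq_le: "expectation (\<lambda>\<omega>. (cmod (Z m \<omega>))\<^sup>2) \<le> 2 * m4 + 2" if m: "m < M" for m
  proof -
    have "expectation (\<lambda>\<omega>. (cmod (Z m \<omega>))\<^sup>2) \<le>
        expectation (\<lambda>\<omega>. (cmod (b i t m \<omega>)) ^ 4 + (cmod (b i' t' m \<omega>)) ^ 4 + 2)"
      using Zsq[OF m] bint[OF m] Zbound by (intro integral_mono) auto
    also have "\<dots> = 2 * m4 + 2"
      using mom(6,7)[OF i(1) m] mom(6,7)[OF i(2) m] by (simp add: prob_space)
    finally show ?thesis .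
  qed
  have "emp_corr M (b i t) (b i' t') \<omega> - d = (\<Sum>m<M. Z m \<omega>) / of_nat M" for \<omega>
    using M by (simp add: emp_corr_def Z_def sum_subtractf diff_divide_distrib)
  moreover have "expectation (\<lambda>\<omega>. cmod ((\<Sum>m<M. Z m \<omega>) / of_nat M)) \<le> sqrt ((2 * m4 + 2) / M)"
    by (rule mean_of_indep_bound[OF indZ _ _ _ M]) (rule Zsq mean Zsq_le, assumption)+
  ultimately show "(\<integral>\<omega>. cmod (emp_corr M (b i t) (b i' t') \<omega> - (if (i, t) = (i', t') then 1 else 0)) \<partial>P) \<le>
      sqrt ((2 * integral\<^sup>L (cnormal 1) (\<lambda>z. cmod z ^ 4) + 2) / M)"
    unfolding d_def[symmetric] m4_def[symmetric] by simp
qed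

section \<open>The rate\<close>

lemma abs_ln_diff_le:
  fixes x y :: real
  assumes "1 \<le> x" "1 \<le> y"
  shows "\<bar>ln x - ln y\<bar> \<le> \<bar>x - y\<bar>"
proof -
  have *: "ln u - ln v \<le> u - v" if "1 \<le> v" "v \<le> u" for u v :: real
  proof -
    have "ln u - ln v = ln (u / v)" using that by (simp add: ln_div)
    also have "\<dots> \<le> u / v - 1" using that by (intro ln_le_minus_one) auto
    also have "\<dots> = (u - v) / v" using that by (simp add: field_simps)
    also have "\<dots> \<le> (u - v) / 1" using that by (intro divide_left_mono) auto
    finally show ?thesis by simp
  qed
  show ?thesis
  proof (cases "x \<le> y")
    case True
    then have "ln x \<le> ln y" using assms by simp
    then show ?thesis using *[of x y] True assms by simp
  next
    case False
    then have "ln y \<le> ln x" using assms by simp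
    then show ?thesis using *[of y x] False assms by simp
  qed
qed

text \<open>On nonnegative arguments \<open>log 2 (1 + x)\<close> is Lipschitz with constant
  \<open>1 / ln 2\<close>, so the error of the expectation is at most a constant times the mean
  error of \<open>X\<close>.\<close>

lemma expectation_log_limit:
  fixes P :: "nat \<Rightarrow> 'w measure"
  assumes prob: "\<forall>\<^sub>F M in sequentially. prob_space (P M)"
    and X: "L1_lim P (\<lambda>M \<omega>. of_real (X M \<omega>)) (of_real c)"
    and nonneg: "\<forall>\<^sub>F M in sequentially. \<forall>\<omega>. 0 \<le> X M \<omega>" and c: "0 \<le> c"
  shows "(\<lambda>M. \<integral>\<omega>. log 2 (1 + X M \<omega>) \<partial>P M) \<longlonglongrightarrow> log 2 (1 + c)"
proof (rule Lim_null[THEN iffD2], rule Lim_null_comparison)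
  have "(\<lambda>M. (\<integral>\<omega>. cmod (complex_of_real (X M \<omega>) - complex_of_real c) \<partial>P M) / ln 2) \<longlonglongrightarrow> 0 / ln 2"
    using X unfolding L1_lim_def by (intro tendsto_divide) auto
  then show "(\<lambda>M. (\<integral>\<omega>. \<bar>X M \<omega> - c\<bar> \<partial>P M) / ln 2) \<longlonglongrightarrow> 0"
    by (simp flip: of_real_diff)
  have "\<forall>\<^sub>F M in sequentially. prob_space (P M) \<and> integrable (P M) (X M) \<and> (\<forall>\<omega>. 0 \<le> X M \<omega>)"
    using X prob nonneg unfolding L1_lim_def complex_of_real_integrable_eq by (auto simp: eventually_conj_iff)
  then show "\<forall>\<^sub>F M in sequentially. norm ((\<integral>\<omega>. log 2 (1 + X M \<omega>) \<partial>P M) - log 2 (1 + c)) \<le>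
      (\<integral>\<omega>. \<bar>X M \<omega> - c\<bar> \<partial>P M) / ln 2"
  proof (rule eventually_mono)
    fix M assume M: "prob_space (P M) \<and> integrable (P M) (X M) \<and> (\<forall>\<omega>. 0 \<le> X M \<omega>)"
    then interpret prob_space "P M" by simp
    have Xint: "integrable (P M) (X M)" and X0: "0 \<le> X M \<omega>" for \<omega> using M by auto
    have [measurable]: "X M \<in> borel_measurable (P M)" using Xint by (rule borel_measurable_integrable)
    \<comment> \<open>Used twice: \<open>a = 0\<close> dominates the logarithm by \<open>X\<close>
      and gives integrability, \<open>a = c\<close> gives the error bound.\<close>
    have lip: "\<bar>log 2 (1 + X M \<omega>) - log 2 (1 + a)\<bar> \<le> \<bar>X M \<omega> - a\<bar> / ln 2" if "0 \<le> a" for a \<omega>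
      using abs_ln_diff_le[of "1 + X M \<omega>" "1 + a"] that X0
      by (simp add: log_def divide_right_mono flip: diff_divide_distrib)
    have Lint: "integrable (P M) (\<lambda>\<omega>. log 2 (1 + X M \<omega>))"
      by (rule Bochner_Integration.integrable_bound[of _ "\<lambda>\<omega>. X M \<omega> / ln 2"])
         (use Xint lip[of 0] X0 in \<open>auto intro!: AE_I2\<close>)
    have "norm (expectation (\<lambda>\<omega>. log 2 (1 + X M \<omega>)) - log 2 (1 + c)) =
        norm (expectation (\<lambda>\<omega>. log 2 (1 + X M \<omega>) - log 2 (1 + c)))"
      using Lint by (simp add: prob_space)
    also have "\<dots> \<le> expectation (\<lambda>\<omega>. \<bar>log 2 (1 + X M \<omega>) - log 2 (1 + c)\<bar>)"
      by (rule order.trans[OF integral_norm_bound]) simp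
    also have "\<dots> \<le> expectation (\<lambda>\<omega>. \<bar>X M \<omega> - c\<bar> / ln 2)"
      using Lint Xint lip[OF c] by (intro integral_mono) auto
    finally show "norm (expectation (\<lambda>\<omega>. log 2 (1 + X M \<omega>)) - log 2 (1 + c)) \<le>
      expectation (\<lambda>\<omega>. \<bar>X M \<omega> - c\<bar>) / ln 2" by simp
  qed
qed

section \<open>Measurability of the zero-forcing gain\<close>

lemma borel_measurable_det:
  fixes A :: "'w \<Rightarrow> complex mat"
  assumes A: "\<And>\<omega>. A \<omega> \<in> carrier_mat n n"
    and meas: "\<And>i j. i < n \<Longrightarrow> j < n \<Longrightarrow> (\<lambda>\<omega>. A \<omega> $$ (i, j)) \<in> borel_measurable N"
  shows "(\<lambda>\<omega>. det (A \<omega>)) \<in> borel_measurable N"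
proof -
  have "(\<lambda>\<omega>. \<Sum>\<pi> \<in> {\<pi>. \<pi> permutes {0..<n}}. signof \<pi> * (\<Prod>i = 0..<n. A \<omega> $$ (i, \<pi> i))) \<in> borel_measurable N"
    by (intro borel_measurable_sum borel_measurable_times borel_measurable_prod borel_measurable_const meas)
       (auto dest: permutes_in_image)
  then show ?thesis unfolding det_def'[OF A] .
qed

text \<open>By the adjugate formula the diagonal entry of the inverse is a minor over the
  determinant, both polynomial in the entries. Singular matrices cause no exception, as inversion
  with \<open>inverse 0 = 0\<close> is Borel measurable.\<close>

lemma borel_measurable_zf_gain:
  fixes A :: "'w \<Rightarrow> complex mat"
  assumes A: "\<And>\<omega>. A \<omega> \<in> carrier_mat n n" and k: "k < n"
    and meas: "\<And>i j. i < n \<Longrightarrow> j < n \<Longrightarrow> (\<lambda>\<omega>. A \<omega> $$ (i, j)) \<in> borel_measurable N"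
  shows "(\<lambda>\<omega>. zf_gain (A \<omega>) k) \<in> borel_measurable N"
proof -
  have dim: "dim_row (A \<omega>) = n" "dim_col (A \<omega>) = n" for \<omega> using A[of \<omega>] by auto
  have gain: "zf_gain (A \<omega>) k = inverse (Re (inverse (det (A \<omega>)) * ((- 1) ^ (k + k) * det (mat_delete (A \<omega>) k k))))" for \<omega>
    using k by (simp add: zf_gain_def minv_eq_adj_mat[OF A] adj_mat_def dim cofactor_def)
  have det: "(\<lambda>\<omega>. det (A \<omega>)) \<in> borel_measurable N" by (rule borel_measurable_det[OF A meas])
  have "(\<lambda>\<omega>. mat_delete (A \<omega>) k k $$ (i, j)) \<in> borel_measurable N" if "i < n - 1" "j < n - 1" for i j
    using that by (auto simp: mat_delete_def dim intro!: meas)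
  then have del: "(\<lambda>\<omega>. det (mat_delete (A \<omega>) k k)) \<in> borel_measurable N"
    by (intro borel_measurable_det[OF mat_delete_carrier[OF A]])
  show ?thesis unfolding gain
    using det del by measurable
qed

text \<open>\<open>pp\<close> times an observation is \<open>sqrt pp\<close> times \<open>y\<close>,
  where \<open>y\<close> is unit noise plus \<open>sqrt pp\<close> times the channel. Two such
  factors \<open>sqrt pp\<close> produce the \<open>pp\<close> in the normalisation, and the
  division by \<open>M\<close> turns antenna sums into empirical correlations.\<close>

lemma gram_predicted_channel:
  fixes g b :: "nat \<Rightarrow> int \<Rightarrow> nat \<Rightarrow> 'w \<Rightarrow> complex" and n :: int
  assumes pp: "0 < pp" and det: "\<And>i. i < K \<Longrightarrow> det (scaled_cov pp (\<beta> i) p \<alpha>) \<noteq> 0"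
    and i: "i < K" "i' < K"
  defines "y \<equiv> \<lambda>i j m \<omega>. b i (n - int j) m \<omega> + of_real (sqrt pp) * g i (n - int j) m \<omega>"
  shows "gram M K (\<lambda>i. predicted_channel M pp (\<beta> i) p \<alpha> (g i) (b i) n \<omega>) $$ (i, i') / of_real (real M * pp) =
    (\<Sum>j<p + 1. \<Sum>j'<p + 1. (cnj (pred_coeff pp (\<beta> i) p \<alpha> j) * pred_coeff pp (\<beta> i') p \<alpha> j') *
       emp_corr M (y i j) (y i' j') \<omega>)"
proof -
  let ?r = "\<lambda>i. pred_coeff pp (\<beta> i) p \<alpha>" and ?s = "complex_of_real (sqrt pp)"
  have s: "?s * ?s = of_real pp" "?s \<noteq> 0" using pp by (simp_all flip: of_real_mult)
  have obs: "of_real pp * observation pp (g i) (b i) (n - int j) m \<omega> = ?s * y i j m \<omega>" for i j m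
  proof -
    have inv: "of_real pp * of_real (1 / sqrt pp) = ?s"
      unfolding of_real_mult[symmetric] using pp by (simp add: real_div_sqrt)
    have "of_real pp * observation pp (g i) (b i) (n - int j) m \<omega> =
        of_real pp * g i (n - int j) m \<omega> + (of_real pp * of_real (1 / sqrt pp)) * b i (n - int j) m \<omega>"
      by (simp only: observation_def distrib_left mult.assoc)
    also have "\<dots> = ?s * ?s * g i (n - int j) m \<omega> + ?s * b i (n - int j) m \<omega>"
      unfolding inv s(1) ..
    also have "\<dots> = ?s * y i j m \<omega>" by (simp add: y_def algebra_simps)
    finally show ?thesis .
  qed
  have h: "predicted_channel M pp (\<beta> i) p \<alpha> (g i) (b i) n \<omega> $ m = ?s * (\<Sum>j<p + 1. ?r i j * y i j m \<omega>)"
    if "i < K" "m < M" for i m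
  proof -
    have "predicted_channel M pp (\<beta> i) p \<alpha> (g i) (b i) n \<omega> $ m =
        (\<Sum>j<p + 1. ?r i j * (of_real pp * observation pp (g i) (b i) (n - int j) m \<omega>))"
      unfolding predicted_channel_index[OF pp det[OF that(1)] that(2)] sum_distrib_left by (simp add: mult_ac)
    also have "\<dots> = ?s * (\<Sum>j<p + 1. ?r i j * y i j m \<omega>)"
      unfolding obs sum_distrib_left by (simp add: mult_ac)
    finally show ?thesis .
  qed
  let ?t = "\<lambda>j j' m. (cnj (?r i j) * ?r i' j') * (cnj (y i j m \<omega>) * y i' j' m \<omega>)"
  have swap: "(\<Sum>m<M. \<Sum>j<p + 1. \<Sum>j'<p + 1. ?t j j' m) = (\<Sum>j<p + 1. \<Sum>j'<p + 1. \<Sum>m<M. ?t j j' m)"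
    by (rule trans[OF sum.swap]) (rule sum.cong[OF refl], rule sum.swap)
  have "gram M K (\<lambda>i. predicted_channel M pp (\<beta> i) p \<alpha> (g i) (b i) n \<omega>) $$ (i, i') =
      (\<Sum>m<M. cnj (?s * (\<Sum>j<p + 1. ?r i j * y i j m \<omega>)) * (?s * (\<Sum>j<p + 1. ?r i' j * y i' j m \<omega>)))"
    using i by (simp add: gram_def h)
  also have "\<dots> = (\<Sum>m<M. of_real pp * (\<Sum>j<p + 1. \<Sum>j'<p + 1. ?t j j' m))"
  proof (rule sum.cong[OF refl])
    fix m
    have scale: "cnj (?s * u) * (?s * v) = of_real pp * (cnj u * v)" for u v
    proof -
      have "cnj (?s * u) * (?s * v) = (?s * ?s) * (cnj u * v)"
        by (simp only: complex_cnj_mult complex_cnj_complex_of_real mult_ac)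
      then show ?thesis unfolding s(1) .
    qed
    have prod: "cnj (\<Sum>j<p + 1. ?r i j * y i j m \<omega>) * (\<Sum>j<p + 1. ?r i' j * y i' j m \<omega>) =
        (\<Sum>j<p + 1. \<Sum>j'<p + 1. ?t j j' m)"
    proof -
      have "cnj (\<Sum>j<p + 1. ?r i j * y i j m \<omega>) * (\<Sum>j<p + 1. ?r i' j * y i' j m \<omega>) =
          (\<Sum>j<p + 1. \<Sum>j'<p + 1. cnj (?r i j * y i j m \<omega>) * (?r i' j' * y i' j' m \<omega>))"
        by (simp only: cnj_sum sum_product)
      also have "\<dots> = (\<Sum>j<p + 1. \<Sum>j'<p + 1. ?t j j' m)"
        by (simp only: complex_cnj_mult mult_ac)
      finally show ?thesis .
    qed
    show "cnj (?s * (\<Sum>j<p + 1. ?r i j * y i j m \<omega>)) * (?s * (\<Sum>j<p + 1. ?r i' j * y i' j m \<omega>)) =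
        of_real pp * (\<Sum>j<p + 1. \<Sum>j'<p + 1. ?t j j' m)"
      unfolding scale prod ..
  qed
  also have "\<dots> = of_real pp * (\<Sum>j<p + 1. \<Sum>j'<p + 1. \<Sum>m<M. ?t j j' m)"
    unfolding sum_distrib_left[symmetric, of "of_real pp"] swap ..
  finally have G: "gram M K (\<lambda>i. predicted_channel M pp (\<beta> i) p \<alpha> (g i) (b i) n \<omega>) $$ (i, i') =
      of_real pp * (\<Sum>j<p + 1. \<Sum>j'<p + 1. \<Sum>m<M. ?t j j' m)" .
  have cancel: "of_real pp * u / of_real (real M * pp) = u / of_nat M" for u :: complex
    using pp by simp
  show ?thesis
    unfolding G cancel emp_corr_def times_divide_eq_right sum_distrib_left sum_divide_distrib ..
qed

text \<open>Expanding the product gives four terms. The noise-noise term obeys the weak law and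
  carries the limit; the other three contain a factor \<open>s\<close> or \<open>s * s\<close> and
  are bounded in mean otherwise.\<close>

lemma observation_corr_limit:
  fixes P :: "nat \<Rightarrow> 'w measure" and g e b :: "nat \<Rightarrow> nat \<Rightarrow> int \<Rightarrow> nat \<Rightarrow> 'w \<Rightarrow> complex"
  assumes up: "\<And>M. M \<ge> K \<Longrightarrow> uplink (P M) M K \<alpha> \<beta> (g M) (e M) (b M)"
    and \<beta>: "\<And>i. i < K \<Longrightarrow> \<beta> i > 0"
    and i: "i < K" "i' < K" and s: "s \<longlonglongrightarrow> 0"
  shows "L1_lim P (\<lambda>M. emp_corr M (\<lambda>m \<omega>. b M i t m \<omega> + of_real (s M) * g M i t m \<omega>)
      (\<lambda>m \<omega>. b M i' t' m \<omega> + of_real (s M) * g M i' t' m \<omega>)) (if (i, t) = (i', t') then 1 else 0)"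
proof -
  have ev: "\<forall>\<^sub>F M in sequentially. K \<le> M" by (rule eventually_ge_at_top)
  have prob: "\<forall>\<^sub>F M in sequentially. prob_space (P M)"
    using ev by (rule eventually_mono) (use up uplink.axioms(1) in blast)
  \<comment> \<open>One bound for the second moments of the unit noise and of the channels of all
    users, so that every mixed term can be treated alike.\<close>
  define C where "C = 1 + (\<Sum>i<K. \<beta> i)"
  have \<beta>C: "\<beta> l \<le> C" if "l < K" for l
    using member_le_sum[of l "{..<K}" \<beta>] \<beta> that unfolding C_def by (fastforce intro: less_imp_le)
  have C1: "1 \<le> C" unfolding C_def using sum_nonneg[of "{..<K}" \<beta>] \<beta> by (force simp: less_imp_le)
  have noise: "b M l u m \<in> borel_measurable (P M)" "integrable (P M) (\<lambda>\<omega>. (cmod (b M l u m \<omega>))\<^sup>2)"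
      "(\<integral>\<omega>. (cmod (b M l u m \<omega>))\<^sup>2 \<partial>P M) \<le> C" if "K \<le> M" "l < K" "m < M" for M l u m
  proof -
    have iid: "iid_cnormal (P M) 1 (\<lambda>(k, n, m). b M k n m) ({..<K} \<times> UNIV \<times> {..<M})"
      using that by (intro uplink.noise_entries[OF up])
    note mom = iid_cnormal_moments[OF uplink.axioms(1)[OF up[OF that(1)]] iid, of "(l, u, m)"]
    show "b M l u m \<in> borel_measurable (P M)" "integrable (P M) (\<lambda>\<omega>. (cmod (b M l u m \<omega>))\<^sup>2)"
      "(\<integral>\<omega>. (cmod (b M l u m \<omega>))\<^sup>2 \<partial>P M) \<le> C"
      using mom(1,4,5) that C1 by simp_all
  qed
  have chan: "g M l u m \<in> borel_measurable (P M)" "integrable (P M) (\<lambda>\<omega>. (cmod (g M l u m \<omega>))\<^sup>2)"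
      "(\<integral>\<omega>. (cmod (g M l u m \<omega>))\<^sup>2 \<partial>P M) \<le> C" if "K \<le> M" "l < K" "m < M" for M l u m
  proof -
    have iid: "iid_cnormal (P M) (\<beta> l) (g M l u) {..<M}"
      using that by (intro uplink.channel_entries[OF up]) auto
    note mom = iid_cnormal_moments[OF uplink.axioms(1)[OF up[OF that(1)]] iid, of m]
    show "g M l u m \<in> borel_measurable (P M)" "integrable (P M) (\<lambda>\<omega>. (cmod (g M l u m \<omega>))\<^sup>2)"
      "(\<integral>\<omega>. (cmod (g M l u m \<omega>))\<^sup>2 \<partial>P M) \<le> C"
      using mom(1,4,5) that \<beta>[of l] \<beta>C[of l] by simp_all
  qed
  have bound: "\<forall>\<^sub>F M in sequentially. integrable (P M) (emp_corr M (X M) (Y M))"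
      "\<forall>\<^sub>F M in sequentially. (\<integral>\<omega>. cmod (emp_corr M (X M) (Y M) \<omega>) \<partial>P M) \<le> C"
    if XY: "\<And>M m. K \<le> M \<Longrightarrow> m < M \<Longrightarrow> X M m \<in> borel_measurable (P M) \<and> integrable (P M) (\<lambda>\<omega>. (cmod (X M m \<omega>))\<^sup>2) \<and>
        (\<integral>\<omega>. (cmod (X M m \<omega>))\<^sup>2 \<partial>P M) \<le> C"
      "\<And>M m. K \<le> M \<Longrightarrow> m < M \<Longrightarrow> Y M m \<in> borel_measurable (P M) \<and> integrable (P M) (\<lambda>\<omega>. (cmod (Y M m \<omega>))\<^sup>2) \<and>
        (\<integral>\<omega>. (cmod (Y M m \<omega>))\<^sup>2 \<partial>P M) \<le> C" for X Y :: "nat \<Rightarrow> nat \<Rightarrow> 'w \<Rightarrow> complex"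
  proof -
    have *: "integrable (P M) (emp_corr M (X M) (Y M)) \<and> (\<integral>\<omega>. cmod (emp_corr M (X M) (Y M) \<omega>) \<partial>P M) \<le> C"
      if M: "K \<le> M" for M
    proof -
      interpret prob_space "P M" using up[OF M] by (rule uplink.axioms(1))
      show ?thesis using emp_corr_bound[of M "X M" "Y M" C] XY[OF M] M i by auto
    qed
    show "\<forall>\<^sub>F M in sequentially. integrable (P M) (emp_corr M (X M) (Y M))"
      "\<forall>\<^sub>F M in sequentially. (\<integral>\<omega>. cmod (emp_corr M (X M) (Y M) \<omega>) \<partial>P M) \<le> C"
      by (rule eventually_mono[OF ev], use * in blast)+
  qed
  have sc: "(\<lambda>M. complex_of_real (s M)) \<longlonglongrightarrow> 0" "(\<lambda>M. complex_of_real (s M * s M)) \<longlonglongrightarrow> 0"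
    using tendsto_of_real[OF s, where ?'a = complex] tendsto_of_real[OF tendsto_mult_zero[OF s s], where ?'a = complex]
    by simp_all
  have bb: "L1_lim P (\<lambda>M. emp_corr M (b M i t) (b M i' t')) (if (i, t) = (i', t') then 1 else 0)"
  proof (rule L1_limI[OF prob])
    let ?m4 = "2 * integral\<^sup>L (cnormal 1) (\<lambda>z. cmod z ^ 4) + 2"
    have *: "integrable (P M) (emp_corr M (b M i t) (b M i' t'))"
      "(\<integral>\<omega>. cmod (emp_corr M (b M i t) (b M i' t') \<omega> - (if (i, t) = (i', t') then 1 else 0)) \<partial>P M) \<le> sqrt (?m4 / real M)"
      if M: "K \<le> M" for M
      using noise_emp_corr[OF uplink.axioms(1)[OF up[OF M]] uplink.noise_entries[OF up[OF M]] i, of t t'] M i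
      by simp_all
    show "\<forall>\<^sub>F M in sequentially. integrable (P M) (emp_corr M (b M i t) (b M i' t'))"
      "\<forall>\<^sub>F M in sequentially. (\<integral>\<omega>. cmod (emp_corr M (b M i t) (b M i' t') \<omega> - (if (i, t) = (i', t') then 1 else 0)) \<partial>P M)
        \<le> sqrt (?m4 / real M)"
      by (rule eventually_mono[OF ev], use * in blast)+
    have "(\<lambda>M. sqrt (?m4 / real M)) \<longlonglongrightarrow> sqrt 0"
      by (intro tendsto_real_sqrt lim_const_over_n)
    then show "(\<lambda>M. sqrt (?m4 / real M)) \<longlonglongrightarrow> 0" by simp
  qed
  have bg: "L1_lim P (\<lambda>M \<omega>. of_real (s M) * emp_corr M (b M i t) (g M i' t') \<omega>) 0"
    by (rule L1_lim_vanishing[OF prob bound sc(1)]) (use noise chan i in auto)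
  have gb: "L1_lim P (\<lambda>M \<omega>. of_real (s M) * emp_corr M (g M i t) (b M i' t') \<omega>) 0"
    by (rule L1_lim_vanishing[OF prob bound sc(1)]) (use noise chan i in auto)
  have gg: "L1_lim P (\<lambda>M \<omega>. of_real (s M * s M) * emp_corr M (g M i t) (g M i' t') \<omega>) 0"
    by (rule L1_lim_vanishing[OF prob bound sc(2)]) (use noise chan i in auto)
  show ?thesis
    using L1_lim_add[OF prob L1_lim_add[OF prob L1_lim_add[OF prob bb bg] gb] gg]
    by (subst emp_corr_add_scaled[abs_def]) simp
qed

text \<open>Formulated for any vanishing power for which \<open>pu^2 * M\<close> converges, so that
  both power scalings are instances.\<close>

lemma rate_limit:
  fixes P :: "nat \<Rightarrow> 'w measure" and g e b :: "nat \<Rightarrow> nat \<Rightarrow> int \<Rightarrow> nat \<Rightarrow> 'w \<Rightarrow> complex"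
  assumes up: "\<And>M. M \<ge> K \<Longrightarrow> uplink (P M) M K \<alpha> \<beta> (g M) (e M) (b M)"
    and \<alpha>: "\<alpha> \<noteq> 0" and \<beta>: "\<And>i. i < K \<Longrightarrow> \<beta> i > 0" and k: "k < K" and \<tau>: "0 < \<tau>"
    and pu_pos: "\<forall>\<^sub>F M in sequentially. 0 < pu M" and pu: "pu \<longlonglongrightarrow> 0"
    and L: "(\<lambda>M. (pu M)\<^sup>2 * real M) \<longlonglongrightarrow> L"
  shows "(\<lambda>M. zf_rate (P M) M K \<tau> (pu M) p \<alpha> \<beta> (g M) (b M) n k) \<longlonglongrightarrow>
    log 2 (1 + real \<tau> * L * (\<alpha>\<^sup>2 * (\<beta> k)\<^sup>2 * (\<Sum>j=0..p. \<alpha> ^ (2 * j))))"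
proof -
  \<comment> \<open>The limit of the \<open>i\<close>-th diagonal entry of the normalised Gram
    matrix: the sum over the taps of the squared limits
    \<open>\<alpha> * \<beta> i * \<alpha> ^ j\<close> of the predictor coefficients.\<close>
  define w where "w i = \<alpha>\<^sup>2 * (\<beta> i)\<^sup>2 * (\<Sum>j=0..p. \<alpha> ^ (2 * j))" for i
  define pp where "pp M = real \<tau> * pu M" for M
  define h where "h M \<omega> i = predicted_channel M (pp M) (\<beta> i) p \<alpha> (g M i) (b M i) n \<omega>" for M \<omega> i
  define B where "B i i' M \<omega> = gram M K (h M \<omega>) $$ (i, i') / of_real (real M * pp M)" for i i' M \<omega>
  define t where "t M = (\<Sum>i<K. \<beta> i - \<alpha>\<^sup>2 * Re (pred_var (pp M) (\<beta> i) p \<alpha>))" for M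
  have prob: "\<forall>\<^sub>F M in sequentially. prob_space (P M)"
    using eventually_ge_at_top[of K] by (rule eventually_mono) (use up uplink.axioms(1) in blast)
  have pp0: "pp \<longlonglongrightarrow> 0" unfolding pp_def using pu by (rule tendsto_mult_right_zero)
  have "(\<lambda>M. sqrt (pp M)) \<longlonglongrightarrow> sqrt 0" using pp0 by (rule tendsto_real_sqrt)
  then have spp: "(\<lambda>M. sqrt (pp M)) \<longlonglongrightarrow> 0" by simp
  have dets: "\<forall>\<^sub>F M in sequentially. \<forall>i\<in>{..<K}. det (scaled_cov (pp M) (\<beta> i) p \<alpha>) \<noteq> 0"
    by (intro eventually_ball_finite ballI scaled_cov_limit(1)[OF pp0]) simp
  have wpos: "0 < w i" if "i < K" for i
  proof -
    have "0 < (\<Sum>j=0..p. \<alpha> ^ (2 * j))"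
      using \<alpha> by (intro sum_pos) (auto simp: power_mult)
    then show ?thesis unfolding w_def using \<alpha> \<beta>[OF that] by simp
  qed
  \<comment> \<open>Finitely many users give a positive lower bound on all limiting diagonal
    entries, as the near-diagonal estimate requires.\<close>
  define c where "c = Min (w ` {..<K})"
  have "w ` {..<K} \<noteq> {}" using k by auto
  then have c: "0 < c" "\<And>i. i < K \<Longrightarrow> c \<le> w i"
    unfolding c_def using wpos by (auto simp: Min_gr_iff)
  define good where "good M \<longleftrightarrow> K \<le> M \<and> 0 < M \<and> prob_space (P M) \<and> 0 < pu M \<and> 0 < pp M \<and>
    (\<forall>i<K. det (scaled_cov (pp M) (\<beta> i) p \<alpha>) \<noteq> 0)" for M
  have good: "\<forall>\<^sub>F M in sequentially. good M"
    using eventually_ge_at_top[of K] eventually_gt_at_top[of 0] prob pu_pos dets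
    by eventually_elim (use \<tau> in \<open>auto simp: good_def pp_def\<close>)
  have hc: "h M \<omega> i \<in> carrier_vec M" for M \<omega> i
    unfolding h_def by (intro carrier_vecI predicted_channel_dim)
  have Blim: "L1_lim P (B i i') (if i = i' then of_real (w i) else 0)" if i: "i < K" "i' < K" for i i'
  proof -
    let ?y = "\<lambda>M i j m \<omega>. b M i (n - int j) m \<omega> + of_real (sqrt (pp M)) * g M i (n - int j) m \<omega>"
    let ?\<rho> = "\<lambda>i j. complex_of_real (\<alpha> * \<beta> i * \<alpha> ^ j)"
    have "\<forall>\<^sub>F M in sequentially. \<forall>\<omega>. B i i' M \<omega> = (\<Sum>j<p + 1. \<Sum>j'<p + 1.
        (cnj (pred_coeff (pp M) (\<beta> i) p \<alpha> j) * pred_coeff (pp M) (\<beta> i') p \<alpha> j') * emp_corr M (?y M i j) (?y M i' j') \<omega>)"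
      using good
    proof (rule eventually_mono, intro allI)
      fix M \<omega> assume "good M"
      then show "B i i' M \<omega> = (\<Sum>j<p + 1. \<Sum>j'<p + 1.
        (cnj (pred_coeff (pp M) (\<beta> i) p \<alpha> j) * pred_coeff (pp M) (\<beta> i') p \<alpha> j') * emp_corr M (?y M i j) (?y M i' j') \<omega>)"
        unfolding B_def h_def good_def using i by (intro gram_predicted_channel) auto
    qed
    moreover have "L1_lim P (\<lambda>M \<omega>. \<Sum>j<p + 1. \<Sum>j'<p + 1.
        (cnj (pred_coeff (pp M) (\<beta> i) p \<alpha> j) * pred_coeff (pp M) (\<beta> i') p \<alpha> j') * emp_corr M (?y M i j) (?y M i' j') \<omega>)
        (\<Sum>j<p + 1. \<Sum>j'<p + 1. (cnj (?\<rho> i j) * ?\<rho> i' j') * (if (i, n - int j) = (i', n - int j') then 1 else 0))"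
      using i by (intro L1_lim_sum[OF prob] L1_lim_scale[OF prob] observation_corr_limit[OF up \<beta> _ _ spp]
          tendsto_mult tendsto_cnj pred_coeff_limit[OF pp0]) auto
    \<comment> \<open>Different taps see noise at different times and different users see different
      noise, so only \<open>i = i'\<close> and \<open>j = j'\<close> survive.\<close>
    moreover have "(\<Sum>j<p + 1. \<Sum>j'<p + 1. (cnj (?\<rho> i j) * ?\<rho> i' j') * (if (i, n - int j) = (i', n - int j') then 1 else 0)) =
        (if i = i' then of_real (w i) else 0)"
    proof -
      have "(\<Sum>j<p + 1. \<Sum>j'<p + 1. (cnj (?\<rho> i j) * ?\<rho> i' j') * (if (i, n - int j) = (i', n - int j') then 1 else 0)) =
          (\<Sum>j<p + 1. \<Sum>j'<p + 1. if j = j' then (if i = i' then ?\<rho> i j * ?\<rho> i j else 0) else 0)"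
        by (intro sum.cong refl) auto
      also have "\<dots> = (\<Sum>j<p + 1. if i = i' then ?\<rho> i j * ?\<rho> i j else 0)" by simp
      also have "\<dots> = (if i = i' then of_real (\<Sum>j<p + 1. (\<alpha> * \<beta> i * \<alpha> ^ j) * (\<alpha> * \<beta> i * \<alpha> ^ j)) else 0)" by simp
      also have "(\<Sum>j<p + 1. (\<alpha> * \<beta> i * \<alpha> ^ j) * (\<alpha> * \<beta> i * \<alpha> ^ j)) = w i"
        unfolding w_def sum_distrib_left
        by (intro sum.cong) (auto simp: power2_eq_square power_mult power_mult_distrib)
      finally show ?thesis .
    qed
    ultimately show ?thesis by (simp only: L1_lim_cong)
  qed
  define Y where "Y M \<omega> = zf_gain (gram M K (h M \<omega>)) k / (real M * pp M)" for M \<omega>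
  have Bint: "\<forall>\<^sub>F M in sequentially. \<forall>i\<in>{..<K}. \<forall>i'\<in>{..<K}. integrable (P M) (B i i' M)"
    using Blim unfolding L1_lim_def by (intro eventually_ball_finite ballI) auto
  define S where "S M \<omega> = (\<Sum>i<K. \<Sum>i'<K. cmod (B i i' M \<omega> - (if i = i' then of_real (w i) else 0)))" for M \<omega>
  have YS: "\<bar>Y M \<omega> - w k\<bar> \<le> (4 * w k / c + 1) * S M \<omega>" if "good M" for M \<omega>
    unfolding Y_def S_def B_def
    by (rule zf_gain_near_diagonal[where w = w and c = c, OF hc k _ c]) (use that in \<open>auto simp: good_def\<close>)
  have Yint: "\<forall>\<^sub>F M in sequentially. good M \<and> integrable (P M) (Y M) \<and>
      (\<forall>i\<in>{..<K}. \<forall>i'\<in>{..<K}. integrable (P M) (B i i' M))"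
    using good Bint
  proof eventually_elim
    case (elim M)
    interpret prob_space "P M" using elim(1) by (simp add: good_def)
    have Mpp: "real M * pp M \<noteq> 0" using elim(1) by (simp add: good_def)
    \<comment> \<open>Measurability of the Gram entries is recovered from integrability of the
      normalised entries \<open>B\<close>, whose scaling factor is nonzero.\<close>
    have "(\<lambda>\<omega>. gram M K (h M \<omega>) $$ (i, i')) \<in> borel_measurable (P M)" if i: "i < K" "i' < K" for i i'
    proof -
      have "(\<lambda>\<omega>. of_real (real M * pp M) * B i i' M \<omega>) \<in> borel_measurable (P M)"
        using elim(2) i by (intro borel_measurable_times borel_measurable_const borel_measurable_integrable) auto
      then show ?thesis using Mpp by (simp add: B_def)
    qed
    then have Ymeas: "Y M \<in> borel_measurable (P M)"
      unfolding Y_def by (intro borel_measurable_divide borel_measurable_const borel_measurable_zf_gain[OF gram_carrier k])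
    have Sint: "integrable (P M) (S M)"
      unfolding S_def using elim(2)
      by (intro Bochner_Integration.integrable_sum integrable_norm Bochner_Integration.integrable_diff) auto
    \<comment> \<open>The pointwise estimate \<open>YS\<close> dominates the error by an integrable
      function, so the gain is integrable although it contains a matrix inverse.\<close>
    have "integrable (P M) (\<lambda>\<omega>. Y M \<omega> - w k)"
    proof (rule Bochner_Integration.integrable_bound)
      show "integrable (P M) (\<lambda>\<omega>. (4 * w k / c + 1) * S M \<omega>)" using Sint by simp
      show "AE \<omega> in P M. norm (Y M \<omega> - w k) \<le> norm ((4 * w k / c + 1) * S M \<omega>)"
        using YS[OF elim(1)] by (intro AE_I2) (auto intro: order.trans[OF _ abs_ge_self])
    qed (use Ymeas in simp)
    then have "integrable (P M) (\<lambda>\<omega>. (Y M \<omega> - w k) + w k)" by (intro Bochner_Integration.integrable_add) auto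
    then show ?case using elim by simp
  qed
  have Ylim: "L1_lim P (\<lambda>M \<omega>. of_real (Y M \<omega>)) (of_real (w k))"
  proof (rule L1_limI[OF prob])
    show "\<forall>\<^sub>F M in sequentially. integrable (P M) (\<lambda>\<omega>. complex_of_real (Y M \<omega>))"
      unfolding complex_of_real_integrable_eq using Yint by (auto elim!: eventually_mono)
    let ?f = "\<lambda>M. (4 * w k / c + 1) * (\<Sum>i<K. \<Sum>i'<K. \<integral>\<omega>. cmod (B i i' M \<omega> - (if i = i' then of_real (w i) else 0)) \<partial>P M)"
    have "?f \<longlonglongrightarrow> (4 * w k / c + 1) * (\<Sum>i<K. \<Sum>i'<K. 0)"
      using Blim unfolding L1_lim_def by (intro tendsto_intros tendsto_sum) auto
    then show "?f \<longlonglongrightarrow> 0" by simp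
    show "\<forall>\<^sub>F M in sequentially. (\<integral>\<omega>. cmod (complex_of_real (Y M \<omega>) - complex_of_real (w k)) \<partial>P M) \<le> ?f M"
      using Yint
    proof (rule eventually_mono)
      fix M assume M: "good M \<and> integrable (P M) (Y M) \<and> (\<forall>i\<in>{..<K}. \<forall>i'\<in>{..<K}. integrable (P M) (B i i' M))"
      then interpret prob_space "P M" by (simp add: good_def)
      have Bi: "integrable (P M) (\<lambda>\<omega>. cmod (B i i' M \<omega> - (if i = i' then of_real (w i) else 0)))"
        if "i \<in> {..<K}" "i' \<in> {..<K}" for i i'
        using M that by (intro integrable_norm Bochner_Integration.integrable_diff) auto
      have Sint: "integrable (P M) (S M)"
        unfolding S_def by (intro Bochner_Integration.integrable_sum Bi)
      have "(\<integral>\<omega>. cmod (complex_of_real (Y M \<omega>) - complex_of_real (w k)) \<partial>P M) = (\<integral>\<omega>. \<bar>Y M \<omega> - w k\<bar> \<partial>P M)"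
        by (simp flip: of_real_diff)
      also have "\<dots> \<le> (\<integral>\<omega>. (4 * w k / c + 1) * S M \<omega> \<partial>P M)"
        using M Sint YS by (intro integral_mono) auto
      also have "\<dots> = (4 * w k / c + 1) * (\<integral>\<omega>. S M \<omega> \<partial>P M)" by simp
      also have "(\<integral>\<omega>. S M \<omega> \<partial>P M) =
          (\<Sum>i<K. \<integral>\<omega>. (\<Sum>i'<K. cmod (B i i' M \<omega> - (if i = i' then of_real (w i) else 0))) \<partial>P M)"
        unfolding S_def by (intro Bochner_Integration.integral_sum Bochner_Integration.integrable_sum Bi)
      also have "\<dots> = (\<Sum>i<K. \<Sum>i'<K. \<integral>\<omega>. cmod (B i i' M \<omega> - (if i = i' then of_real (w i) else 0)) \<partial>P M)"
        by (intro sum.cong refl Bochner_Integration.integral_sum Bi)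
      finally show "(\<integral>\<omega>. cmod (complex_of_real (Y M \<omega>) - complex_of_real (w k)) \<partial>P M) \<le> ?f M" .
    qed
  qed
  \<comment> \<open>The error variances converge while \<open>pu\<close> vanishes, so in the limit
    only the unit noise is left in the denominator.\<close>
  have "(\<lambda>M. pu M * t M + 1) \<longlonglongrightarrow> 0 * (\<Sum>i<K. \<beta> i - \<alpha>\<^sup>2 * Re 0) + 1"
    unfolding t_def by (intro tendsto_intros tendsto_sum tendsto_Re pred_var_limit[OF pp0] pu)
  then have den: "(\<lambda>M. pu M * t M + 1) \<longlonglongrightarrow> 1" by simp
  \<comment> \<open>The deterministic factor of the SINR: \<open>pu\<close> times the normalisation
    \<open>M * pp\<close> equals \<open>\<tau> * pu^2 * M\<close>.\<close>
  define \<Lambda> where "\<Lambda> M = real \<tau> * ((pu M)\<^sup>2 * real M) / (pu M * t M + 1)" for M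
  have "\<Lambda> \<longlonglongrightarrow> real \<tau> * L / 1"
    unfolding \<Lambda>_def by (intro tendsto_intros L den) simp
  then have \<Lambda>: "\<Lambda> \<longlonglongrightarrow> real \<tau> * L" by simp
  have Xlim: "L1_lim P (\<lambda>M \<omega>. of_real (\<Lambda> M * Y M \<omega>)) (of_real (real \<tau> * L * w k))"
    using L1_lim_scale[OF prob Ylim tendsto_of_real[OF \<Lambda>]] by simp
  have \<Lambda>Y: "\<forall>\<^sub>F M in sequentially. \<forall>\<omega>. 0 \<le> \<Lambda> M * Y M \<omega>"
    using order_tendstoD(1)[OF den, of 0, simplified] good
  proof (eventually_elim, intro allI)
    fix M \<omega> assume M: "0 < pu M * t M + 1" "good M"
    have "0 \<le> Y M \<omega>"
      unfolding Y_def using zf_gain_nonneg[where h = "h M \<omega>", OF hc k] M(2) by (auto simp: good_def)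
    then show "0 \<le> \<Lambda> M * Y M \<omega>" unfolding \<Lambda>_def using M(1) by simp
  qed
  have L0: "0 \<le> L" by (rule tendsto_lowerbound[OF L]) auto
  have "(\<lambda>M. \<integral>\<omega>. log 2 (1 + \<Lambda> M * Y M \<omega>) \<partial>P M) \<longlonglongrightarrow> log 2 (1 + real \<tau> * L * w k)"
    by (rule expectation_log_limit[OF prob Xlim \<Lambda>Y]) (use L0 wpos[OF k] in auto)
  moreover have "\<forall>\<^sub>F M in sequentially. (\<integral>\<omega>. log 2 (1 + \<Lambda> M * Y M \<omega>) \<partial>P M) =
      zf_rate (P M) M K \<tau> (pu M) p \<alpha> \<beta> (g M) (b M) n k"
    using good
  proof (rule eventually_mono)
    fix M assume M: "good M"
    have tr: "(\<Sum>i<K. 1 / real M *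
       Re (mat_trace (of_real (\<beta> i) \<cdot>\<^sub>m 1\<^sub>m M - of_real (\<alpha>\<^sup>2) \<cdot>\<^sub>m Theta_mat M (pp M) (\<beta> i) p \<alpha>))) = t M"
      unfolding t_def using M by (intro sum.cong refl trace_error) (auto simp: good_def)
    have "sinr M K (pu M) (pp M) \<beta> p \<alpha> (zf_detector M K (h M \<omega>) k) (h M \<omega>) k = \<Lambda> M * Y M \<omega>" for \<omega>
    proof -
      have "sinr M K (pu M) (pp M) \<beta> p \<alpha> (zf_detector M K (h M \<omega>) k) (h M \<omega>) k =
          pu M * zf_gain (gram M K (h M \<omega>)) k / (pu M * t M + 1)"
        unfolding sinr_zf_detector[where h = "h M \<omega>", OF hc k] tr ..
      also have "\<dots> = \<Lambda> M * Y M \<omega>"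
        using M \<tau> unfolding \<Lambda>_def Y_def pp_def good_def by (simp add: power2_eq_square)
      finally show ?thesis .
    qed
    moreover have "zf_rate (P M) M K \<tau> (pu M) p \<alpha> \<beta> (g M) (b M) n k =
        (\<integral>\<omega>. log 2 (1 + sinr M K (pu M) (pp M) \<beta> p \<alpha> (zf_detector M K (h M \<omega>) k) (h M \<omega>) k) \<partial>P M)"
      by (simp add: zf_rate_def Let_def h_def[abs_def] pp_def)
    ultimately show "(\<integral>\<omega>. log 2 (1 + \<Lambda> M * Y M \<omega>) \<partial>P M) = zf_rate (P M) M K \<tau> (pu M) p \<alpha> \<beta> (g M) (b M) n k"
      by simp
  qed
  ultimately show ?thesis
    unfolding w_def by (rule Lim_transform_eventually)
qed

theorem corollary3:
  fixes P :: "nat \<Rightarrow> 'w measure"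
    and K \<tau> p k :: nat
    and \<alpha> E\<^sub>u :: real
    and \<beta> :: "nat \<Rightarrow> real"
    and g e b :: "nat \<Rightarrow> nat \<Rightarrow> int \<Rightarrow> nat \<Rightarrow> 'w \<Rightarrow> complex"
    and n :: int
  assumes "\<And>M. M \<ge> K \<Longrightarrow> uplink (P M) M K \<alpha> \<beta> (g M) (e M) (b M)"
    and "\<tau> \<ge> K"
    and "0 < \<bar>\<alpha>\<bar>" and "\<bar>\<alpha>\<bar> \<le> 1"
    and "\<And>i. i < K \<Longrightarrow> \<beta> i > 0"
    and "E\<^sub>u > 0"
    and "k < K"
  shows "((\<lambda>M. zf_rate (P M) M K \<tau> (E\<^sub>u / sqrt (real M)) p \<alpha> \<beta> (g M) (b M) n k)
            \<longlonglongrightarrow> log 2 (1 + \<alpha>\<^sup>2 * (\<Sum>j=0..p. \<alpha> ^ (2 * j)) * real \<tau> * E\<^sub>u\<^sup>2 * (\<beta> k)\<^sup>2)) \<and>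
         (\<forall>\<gamma>>1/2.
            (\<lambda>M. zf_rate (P M) M K \<tau> (E\<^sub>u / real M powr \<gamma>) p \<alpha> \<beta> (g M) (b M) n k) \<longlonglongrightarrow> 0)"
proof (intro conjI allI impI)
  have \<alpha>: "\<alpha> \<noteq> 0" and \<tau>: "0 < \<tau>" using assms by auto
  note rate = rate_limit[where P = P and g = g and e = e and b = b and p = p and n = n, OF assms(1) \<alpha> assms(5,7) \<tau>]
  have "(\<lambda>M. zf_rate (P M) M K \<tau> (E\<^sub>u / sqrt (real M)) p \<alpha> \<beta> (g M) (b M) n k) \<longlonglongrightarrow>
      log 2 (1 + real \<tau> * E\<^sub>u\<^sup>2 * (\<alpha>\<^sup>2 * (\<beta> k)\<^sup>2 * (\<Sum>j=0..p. \<alpha> ^ (2 * j))))"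
  proof (rule rate)
    show "\<forall>\<^sub>F M in sequentially. 0 < E\<^sub>u / sqrt (real M)"
      using eventually_gt_at_top[of 0] by eventually_elim (use assms(6) in simp)
    show "(\<lambda>M. E\<^sub>u / sqrt (real M)) \<longlonglongrightarrow> 0" by real_asymp
    \<comment> \<open>At the critical scaling \<open>pu^2 * M\<close> is constant for positive
      \<open>M\<close>, so \<open>L\<close> is its value.\<close>
    have "\<forall>\<^sub>F M in sequentially. E\<^sub>u\<^sup>2 = (E\<^sub>u / sqrt (real M))\<^sup>2 * real M"
      using eventually_gt_at_top[of 0] by eventually_elim (simp add: power_divide)
    then show "(\<lambda>M. (E\<^sub>u / sqrt (real M))\<^sup>2 * real M) \<longlonglongrightarrow> E\<^sub>u\<^sup>2"
      by (rule Lim_transform_eventually[OF tendsto_const])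
  qed
  then show "(\<lambda>M. zf_rate (P M) M K \<tau> (E\<^sub>u / sqrt (real M)) p \<alpha> \<beta> (g M) (b M) n k)
      \<longlonglongrightarrow> log 2 (1 + \<alpha>\<^sup>2 * (\<Sum>j=0..p. \<alpha> ^ (2 * j)) * real \<tau> * E\<^sub>u\<^sup>2 * (\<beta> k)\<^sup>2)"
    by (simp add: mult_ac)
  fix \<gamma> :: real assume \<gamma>: "1 / 2 < \<gamma>"
  have "(\<lambda>M. zf_rate (P M) M K \<tau> (E\<^sub>u / real M powr \<gamma>) p \<alpha> \<beta> (g M) (b M) n k) \<longlonglongrightarrow>
      log 2 (1 + real \<tau> * 0 * (\<alpha>\<^sup>2 * (\<beta> k)\<^sup>2 * (\<Sum>j=0..p. \<alpha> ^ (2 * j))))"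
  proof (rule rate)
    show "\<forall>\<^sub>F M in sequentially. 0 < E\<^sub>u / real M powr \<gamma>"
      using eventually_gt_at_top[of 0] by eventually_elim (use assms(6) in simp)
    show "(\<lambda>M. E\<^sub>u / real M powr \<gamma>) \<longlonglongrightarrow> 0" using \<gamma> by real_asymp
    \<comment> \<open>Here \<open>pu^2 * M\<close> decays like \<open>M\<close> to the power
      \<open>1 - 2 * \<gamma>\<close>, which is negative, so \<open>L = 0\<close> and the limiting
      rate is \<open>log 2 1 = 0\<close>.\<close>
    define \<delta> where "\<delta> = 2 * \<gamma> - 1"
    have "0 < \<delta>" using \<gamma> by (simp add: \<delta>_def)
    then have lim: "(\<lambda>M. E\<^sub>u\<^sup>2 * real M powr (- \<delta>)) \<longlonglongrightarrow> 0" by real_asymp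
    have "\<forall>\<^sub>F M in sequentially. E\<^sub>u\<^sup>2 * real M powr (- \<delta>) = (E\<^sub>u / real M powr \<gamma>)\<^sup>2 * real M"
      using eventually_gt_at_top[of 0]
    proof eventually_elim
      case (elim M)
      have "real M powr (- \<delta>) = real M powr (1 - (\<gamma> + \<gamma>))" by (simp add: \<delta>_def)
      also have "\<dots> = real M / (real M powr \<gamma>)\<^sup>2"
        using elim by (simp only: powr_diff powr_add power2_eq_square) simp
      finally show ?case by (simp add: power_divide)
    qed
    then show "(\<lambda>M. (E\<^sub>u / real M powr \<gamma>)\<^sup>2 * real M) \<longlonglongrightarrow> 0"
      by (rule Lim_transform_eventually[OF lim])
  qed
  then show "(\<lambda>M. zf_rate (P M) M K \<tau> (E\<^sub>u / real M powr \<gamma>) p \<alpha> \<beta> (g M) (b M) n k) \<longlonglongrightarrow> 0"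
    by simp
qed

end
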